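(* For any program $M:b$ of base type $b$: if $\models_{\mathcal S}M\downarrow_b$ then there exists a constant $c:b$ such that $\vdash_{\mathrm{Ax}}M=c:b$.
   Context: **Language.** Fix base types $b$, including $\mathtt{Bool}$ and $\mathtt{Rew}$; for each $b$ a set of constants $c:b$ (including $\mathtt{tt},\mathtt{ff}:\mathtt{Bool}$, $0:\mathtt{Rew}$); and function symbols $f:b_1\ldots b_m\to b$, including $=_b\,:b\,b\to\mathtt{Bool}$ for each $b$, $+:\mathtt{Rew}\,\mathtt{Rew}\to\mathtt{Rew}$ and $\le\,:\mathtt{Rew}\,\mathtt{Rew}\to\mathtt{Bool}$ ($x\ge y$ means $y\le x$). Types: $\sigma::=b\mid\mathtt{Unit}\mid\sigma\times\sigma\mid\sigma\to\sigma$. Terms: $M::=x\mid c\mid f(M_1,\dots,M_m)\mid\mathtt{if}\,L\,\mathtt{then}\,M\,\mathtt{else}\,N\mid M\,\mathtt{or}\,N\mid N\cdot M\mid *\mid\langle M,N\rangle\mid\mathtt{fst}(M)\mid\mathtt{snd}(M)\mid\lambda x{:}\sigma.M\mid MN$, up to $\alpha$-equivalence, with standard simple typing; $M\,\mathtt{or}\,N:\sigma$ when $M,N:\sigma$, and $N\cdot M:\sigma$ when $N:\mathtt{Rew}$, $M:\sigma$. $\mathtt{let}\,x{:}\sigma\,\mathtt{be}\,M\,\mathtt{in}\,N$ abbreviates $(\lambda x{:}\sigma.N)M$. Programs are closed well-typed terms. Constants $\mathrm{val}_f(c_1,\dots,c_m):b$ are given for all $f:b_1\ldots b_m\to b$ and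 $c_i:b_i$, with $\mathrm{val}_{=_b}(c,c')=\mathtt{tt}$ if $c=c'$, else $\mathtt{ff}$. **Rewards and interpretation.** $R$ is a set with a commutative monoid structure $(+,0)$ and a total order $\le$ such that $r\le s\iff r+t\le s+t$. Given are nonempty sets $[\![b]\!]$ with $[\![\mathtt{Bool}]\!]=\{0,1\}$, $[\![\mathtt{Rew}]\!]=R$; elements $[\![c]\!]\in[\![b]\!]$ for $c:b$ with $[\![\mathtt{tt}]\!]=1$, $[\![\mathtt{ff}]\!]=0$, $[\![0]\!]=0$, distinct constants of the same type having distinct denotations, and $[\![c]\!]\ne0$ for some $c:\mathtt{Rew}$; and functions $[\![f]\!]:[\![b_1]\!]\times\cdots\times[\![b_m]\!]\to[\![b]\!]$ with $[\![+]\!]$ and $[\![\le]\!]$ the addition and (characteristic function of the) order of $R$, and $[\![f]\!]([\![c_1]\!],\dots,[\![c_m]\!])=[\![\mathrm{val}_f(c_1,\dots,c_m)]\!]$. **Denotational semantics.** $S(X)=(X\to R)\to R\times X$. For $F\in S(X)$, $\gamma:X\to R$ put $\mathbf R(F|\gamma)=r+\gamma(x)$ where $\langle r,x\rangle=F(\gamma)$. $S$ is a monad with $\eta(x)(\gamma)=\langle0,x\rangle$ and, for $f:X\to S(Y)$, $f^\dagger(F)(\gamma)=\langle r+s,y\rangle$ where $\langle r,x\rangle=F(\lambda x'.\,\mathbf R(f(x')|\gamma))$ and $\langle s,y\rangle=f(x)(\gamma)$. Operations: $(G_0\,\mathtt{or}\,G_1)(\gamma)=G_0(\gamma)$ if $\mathbf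 R(G_0|\gamma)\ge\mathbf R(G_1|\gamma)$, else $G_1(\gamma)$; $(r\cdot G)(\gamma)=\langle r+s,x\rangle$ where $\langle s,x\rangle=G(\gamma)$. Types: $\mathcal S[\![b]\!]=[\![b]\!]$, $\mathcal S[\![\mathtt{Unit}]\!]=\{*\}$, $\mathcal S[\![\sigma\times\tau]\!]=\mathcal S[\![\sigma]\!]\times\mathcal S[\![\tau]\!]$, $\mathcal S[\![\sigma\to\tau]\!]=\mathcal S[\![\sigma]\!]\to S(\mathcal S[\![\tau]\!])$. A term $\Gamma\vdash M:\sigma$ denotes $\mathcal S[\![M]\!]:\mathcal S[\![\Gamma]\!]\to S(\mathcal S[\![\sigma]\!])$ by the standard left-to-right call-by-value monadic semantics: variables, constants, $*$ and abstractions via $\eta$ ($\mathcal S[\![\lambda x{:}\sigma.M]\!](\rho)=\eta(a\mapsto\mathcal S[\![M]\!](\rho,a))$); pairs, projections, applications, function symbols and conditions of conditionals by sequencing arguments left to right with Kleisli extension; $\mathcal S[\![M\,\mathtt{or}\,N]\!](\rho)=\mathcal S[\![M]\!](\rho)\,\mathtt{or}\,\mathcal S[\![N]\!](\rho)$; $\mathcal S[\![N\cdot M]\!](\rho)=(r\mapsto r\cdot\mathcal S[\![M]\!](\rho))^\dagger(\mathcal S[\![N]\!](\rho))$. For a program $M:b$, $\models_{\mathcal S}M\downarrow_b$ means that $\mathcal S[\![M]\!]=\eta(a)$ for some $a\in[\![b]\!]$. **Equational logic.** Assertions are $\Gamma\vdash M=N:\sigma$ and purity assertions $\Gamma\vdash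 M\downarrow_\sigma$, for terms of type $\sigma$ in $\Gamma$. $\vdash_{\mathrm{Ax}}$ is derivability from a set $\mathrm{Ax}$ of assertions by the following (Moggi's computational $\lambda$-calculus, extended to this language). *Rules*: $=$ is an equivalence relation and a congruence for all term constructors; if $M=N$ and $M\downarrow$ then $N\downarrow$; weakening; if $\Gamma\vdash M\downarrow_\sigma$ and an assertion $A$ is derivable in $\Gamma,x{:}\sigma$ then $A[M/x]$ is derivable in $\Gamma$. *Purity*: $x\downarrow$, $c\downarrow$, $*\downarrow$, $(\lambda x{:}\sigma.M)\downarrow$, $\langle x,y\rangle\downarrow$, $\mathtt{fst}(x)\downarrow$, $\mathtt{snd}(x)\downarrow$. *Let*: $\mathtt{let}\,x\,\mathtt{be}\,M\,\mathtt{in}\,x=M$; $\mathtt{let}\,x_2\,\mathtt{be}\,(\mathtt{let}\,x_1\,\mathtt{be}\,M_1\,\mathtt{in}\,M_2)\,\mathtt{in}\,N=\mathtt{let}\,x_1\,\mathtt{be}\,M_1\,\mathtt{in}\,\mathtt{let}\,x_2\,\mathtt{be}\,M_2\,\mathtt{in}\,N$ ($x_1\notin FV(N)$). *Evaluation order* (fresh variables): $MN=\mathtt{let}\,x\,\mathtt{be}\,M\,\mathtt{in}\,\mathtt{let}\,y\,\mathtt{be}\,N\,\mathtt{in}\,xy$, and likewise for pairs, projections, function symbol applications (left to right) and the condition of a conditional. *Structural*: $(\lambda x{:}\sigma.M)x=M$; $\lambda x{:}\sigma.\,yx=y$; $\mathtt{fst}\langle x,y\rangle=x$; $\mathtt{snd}\langle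 x,y\rangle=y$; $\langle\mathtt{fst}(x),\mathtt{snd}(x)\rangle=x$; $x=*$ for $x:\mathtt{Unit}$. *Conditionals*: $\mathtt{if}\,\mathtt{tt}\,\mathtt{then}\,M\,\mathtt{else}\,N=M$; $\mathtt{if}\,\mathtt{ff}\,\mathtt{then}\,M\,\mathtt{else}\,N=N$; $u(x)=\mathtt{if}\,x\,\mathtt{then}\,u(\mathtt{tt})\,\mathtt{else}\,u(\mathtt{ff})$. *Function symbols*: $f(c_1,\dots,c_m)=\mathrm{val}_f(c_1,\dots,c_m)$. *Algebraic operations* ($u$ a variable of function type): $u(M\,\mathtt{or}\,N)=u(M)\,\mathtt{or}\,u(N)$; $u(y\cdot M)=y\cdot u(M)$; $N\cdot M=\mathtt{let}\,y{:}\mathtt{Rew}\,\mathtt{be}\,N\,\mathtt{in}\,y\cdot M$ ($y\notin FV(M)$). **The axioms $\mathrm{Ax}$** (all terms $L,M,N$ of a common type; $x,y,z$ variables of type $\mathtt{Rew}$): $(L\,\mathtt{or}\,M)\,\mathtt{or}\,N=L\,\mathtt{or}\,(M\,\mathtt{or}\,N)$; $M\,\mathtt{or}\,M=M$; $0\cdot N=N$; $x\cdot(y\cdot N)=(x+y)\cdot N$; $x\cdot(M\,\mathtt{or}\,N)=(x\cdot M)\,\mathtt{or}\,(x\cdot N)$; $\mathtt{if}\,x\ge y\,\mathtt{then}\,x\cdot M\,\mathtt{else}\,y\cdot M=x\cdot M\,\mathtt{or}\,y\cdot M$; $\mathtt{if}\,x\ge z\,\mathtt{then}\,(x\cdot M\,\mathtt{or}\,N)\,\mathtt{else}\,(N\,\mathtt{or}\,z\cdot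 M)=(x\cdot M\,\mathtt{or}\,N)\,\mathtt{or}\,z\cdot M$. *)

theory Defs
  imports "HOL-Library.FuncSet"
begin

section \<open>Language\<close>

datatype 'b ty =
    TBase 'b
  | TUnit
  | TProd "'b ty" "'b ty"
  | TFun "'b ty" "'b ty"

text \<open>Terms up to alpha-equivalence, as terms with de Bruijn indices; the abstraction carries the
  type of its bound variable.  \<open>Func f Ms\<close> is \<open>f(M1,...,Mm)\<close>, \<open>Act N M\<close> is \<open>N \<cdot> M\<close>.\<close>

datatype ('b, 'c, 'f) tm =
    Var nat
  | Const 'c
  | Func 'f "('b, 'c, 'f) tm list"
  | Cond "('b, 'c, 'f) tm" "('b, 'c, 'f) tm" "('b, 'c, 'f) tm"
  | Or "('b, 'c, 'f) tm" "('b, 'c, 'f) tm"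
  | Act "('b, 'c, 'f) tm" "('b, 'c, 'f) tm"
  | Star
  | Tuple "('b, 'c, 'f) tm" "('b, 'c, 'f) tm"
  | Fst "('b, 'c, 'f) tm"
  | Snd "('b, 'c, 'f) tm"
  | Lam "'b ty" "('b, 'c, 'f) tm"
  | App "('b, 'c, 'f) tm" "('b, 'c, 'f) tm"

fun lift :: "nat \<Rightarrow> ('b, 'c, 'f) tm \<Rightarrow> ('b, 'c, 'f) tm" where
  "lift k (Var i) = (if i < k then Var i else Var (Suc i))"
| "lift k (Const c) = Const c"
| "lift k (Func f Ms) = Func f (map (lift k) Ms)"
| "lift k (Cond L M N) = Cond (lift k L) (lift k M) (lift k N)"
| "lift k (Or M N) = Or (lift k M) (lift k N)"
| "lift k (Act N M) = Act (lift k N) (lift k M)"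
| "lift k Star = Star"
| "lift k (Tuple M N) = Tuple (lift k M) (lift k N)"
| "lift k (Fst M) = Fst (lift k M)"
| "lift k (Snd M) = Snd (lift k M)"
| "lift k (Lam \<sigma> M) = Lam \<sigma> (lift (Suc k) M)"
| "lift k (App M N) = App (lift k M) (lift k N)"

text \<open>\<open>subst k V M\<close> replaces index \<open>k\<close> by \<open>V\<close> and lowers the indices above \<open>k\<close>; \<open>V\<close> lives in the
  context with position \<open>k\<close> removed.\<close>

fun subst :: "nat \<Rightarrow> ('b, 'c, 'f) tm \<Rightarrow> ('b, 'c, 'f) tm \<Rightarrow> ('b, 'c, 'f) tm" where
  "subst k V (Var i) = (if i < k then Var i else if i = k then V else Var (i - 1))"
| "subst k V (Const c) = Const c"
| "subst k V (Func f Ms) = Func f (map (subst k V) Ms)"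
| "subst k V (Cond L M N) = Cond (subst k V L) (subst k V M) (subst k V N)"
| "subst k V (Or M N) = Or (subst k V M) (subst k V N)"
| "subst k V (Act N M) = Act (subst k V N) (subst k V M)"
| "subst k V Star = Star"
| "subst k V (Tuple M N) = Tuple (subst k V M) (subst k V N)"
| "subst k V (Fst M) = Fst (subst k V M)"
| "subst k V (Snd M) = Snd (subst k V M)"
| "subst k V (Lam \<sigma> M) = Lam \<sigma> (subst (Suc k) (lift 0 V) M)"
| "subst k V (App M N) = App (subst k V M) (subst k V N)"

text \<open>\<open>Let \<sigma> M N\<close> is \<open>let x:\<sigma> be M in N\<close>, where \<open>x\<close> is index 0 in \<open>N\<close>.\<close>

abbreviation LetT :: "'b ty \<Rightarrow> ('b, 'c, 'f) tm \<Rightarrow> ('b, 'c, 'f) tm \<Rightarrow> ('b, 'c, 'f) tm" where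
  "LetT \<sigma> M N \<equiv> App (Lam \<sigma> N) M"

text \<open>The elements of \<open>'b\<close>, \<open>'c\<close>, \<open>'f\<close> are the base types, constants and function symbols.\<close>

record ('b, 'c, 'f) signature =
  boolT :: 'b
  rewT :: 'b
  cty :: "'c \<Rightarrow> 'b"
  fargs :: "'f \<Rightarrow> 'b list"
  fres :: "'f \<Rightarrow> 'b"
  ttC :: 'c
  ffC :: 'c
  zeroC :: 'c
  eqF :: "'b \<Rightarrow> 'f"
  plusF :: 'f
  leqF :: 'f
  fval :: "'f \<Rightarrow> 'c list \<Rightarrow> 'c"

definition signature_ok :: "('b, 'c, 'f) signature \<Rightarrow> bool" where
  "signature_ok \<Sigma> \<longleftrightarrow>
     boolT \<Sigma> \<noteq> rewT \<Sigma> \<and>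
     cty \<Sigma> (ttC \<Sigma>) = boolT \<Sigma> \<and> cty \<Sigma> (ffC \<Sigma>) = boolT \<Sigma> \<and> cty \<Sigma> (zeroC \<Sigma>) = rewT \<Sigma> \<and>
     (\<forall>b. fargs \<Sigma> (eqF \<Sigma> b) = [b, b] \<and> fres \<Sigma> (eqF \<Sigma> b) = boolT \<Sigma>) \<and>
     fargs \<Sigma> (plusF \<Sigma>) = [rewT \<Sigma>, rewT \<Sigma>] \<and> fres \<Sigma> (plusF \<Sigma>) = rewT \<Sigma> \<and>
     fargs \<Sigma> (leqF \<Sigma>) = [rewT \<Sigma>, rewT \<Sigma>] \<and> fres \<Sigma> (leqF \<Sigma>) = boolT \<Sigma> \<and>
     (\<forall>f cs. map (cty \<Sigma>) cs = fargs \<Sigma> f \<longrightarrow> cty \<Sigma> (fval \<Sigma> f cs) = fres \<Sigma> f) \<and>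
     (\<forall>b c c'. cty \<Sigma> c = b \<and> cty \<Sigma> c' = b \<longrightarrow>
        fval \<Sigma> (eqF \<Sigma> b) [c, c'] = (if c = c' then ttC \<Sigma> else ffC \<Sigma>))"

text \<open>Contexts are lists of types; position \<open>i\<close> is the type of index \<open>i\<close>.\<close>

inductive typing :: "('b, 'c, 'f) signature \<Rightarrow> 'b ty list \<Rightarrow> ('b, 'c, 'f) tm \<Rightarrow> 'b ty \<Rightarrow> bool"
  for \<Sigma> where
  "i < length \<Gamma> \<Longrightarrow> \<Gamma> ! i = \<sigma> \<Longrightarrow> typing \<Sigma> \<Gamma> (Var i) \<sigma>"
| "cty \<Sigma> c = b \<Longrightarrow> typing \<Sigma> \<Gamma> (Const c) (TBase b)"
| "list_all2 (\<lambda>M b. typing \<Sigma> \<Gamma> M (TBase b)) Ms (fargs \<Sigma> f) \<Longrightarrow> fres \<Sigma> f = b \<Longrightarrow>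
     typing \<Sigma> \<Gamma> (Func f Ms) (TBase b)"
| "typing \<Sigma> \<Gamma> L (TBase (boolT \<Sigma>)) \<Longrightarrow> typing \<Sigma> \<Gamma> M \<sigma> \<Longrightarrow> typing \<Sigma> \<Gamma> N \<sigma> \<Longrightarrow>
     typing \<Sigma> \<Gamma> (Cond L M N) \<sigma>"
| "typing \<Sigma> \<Gamma> M \<sigma> \<Longrightarrow> typing \<Sigma> \<Gamma> N \<sigma> \<Longrightarrow> typing \<Sigma> \<Gamma> (Or M N) \<sigma>"
| "typing \<Sigma> \<Gamma> N (TBase (rewT \<Sigma>)) \<Longrightarrow> typing \<Sigma> \<Gamma> M \<sigma> \<Longrightarrow> typing \<Sigma> \<Gamma> (Act N M) \<sigma>"
| "typing \<Sigma> \<Gamma> Star TUnit"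
| "typing \<Sigma> \<Gamma> M \<sigma> \<Longrightarrow> typing \<Sigma> \<Gamma> N \<tau> \<Longrightarrow> typing \<Sigma> \<Gamma> (Tuple M N) (TProd \<sigma> \<tau>)"
| "typing \<Sigma> \<Gamma> M (TProd \<sigma> \<tau>) \<Longrightarrow> typing \<Sigma> \<Gamma> (Fst M) \<sigma>"
| "typing \<Sigma> \<Gamma> M (TProd \<sigma> \<tau>) \<Longrightarrow> typing \<Sigma> \<Gamma> (Snd M) \<tau>"
| "typing \<Sigma> (\<sigma> # \<Gamma>) M \<tau> \<Longrightarrow> typing \<Sigma> \<Gamma> (Lam \<sigma> M) (TFun \<sigma> \<tau>)"
| "typing \<Sigma> \<Gamma> M (TFun \<sigma> \<tau>) \<Longrightarrow> typing \<Sigma> \<Gamma> N \<sigma> \<Longrightarrow> typing \<Sigma> \<Gamma> (App M N) \<tau>"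

definition program :: "('b, 'c, 'f) signature \<Rightarrow> ('b, 'c, 'f) tm \<Rightarrow> 'b ty \<Rightarrow> bool" where
  "program \<Sigma> M \<sigma> \<longleftrightarrow> typing \<Sigma> [] M \<sigma>"

text \<open>The type of a term in a context, as a function; it is meaningful on well-typed terms only.\<close>

fun tyof :: "('b, 'c, 'f) signature \<Rightarrow> 'b ty list \<Rightarrow> ('b, 'c, 'f) tm \<Rightarrow> 'b ty" where
  "tyof \<Sigma> \<Gamma> (Var i) = \<Gamma> ! i"
| "tyof \<Sigma> \<Gamma> (Const c) = TBase (cty \<Sigma> c)"
| "tyof \<Sigma> \<Gamma> (Func f Ms) = TBase (fres \<Sigma> f)"
| "tyof \<Sigma> \<Gamma> (Cond L M N) = tyof \<Sigma> \<Gamma> M"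
| "tyof \<Sigma> \<Gamma> (Or M N) = tyof \<Sigma> \<Gamma> M"
| "tyof \<Sigma> \<Gamma> (Act N M) = tyof \<Sigma> \<Gamma> M"
| "tyof \<Sigma> \<Gamma> Star = TUnit"
| "tyof \<Sigma> \<Gamma> (Tuple M N) = TProd (tyof \<Sigma> \<Gamma> M) (tyof \<Sigma> \<Gamma> N)"
| "tyof \<Sigma> \<Gamma> (Fst M) = (case tyof \<Sigma> \<Gamma> M of TProd \<sigma> \<tau> \<Rightarrow> \<sigma> | _ \<Rightarrow> TUnit)"
| "tyof \<Sigma> \<Gamma> (Snd M) = (case tyof \<Sigma> \<Gamma> M of TProd \<sigma> \<tau> \<Rightarrow> \<tau> | _ \<Rightarrow> TUnit)"
| "tyof \<Sigma> \<Gamma> (Lam \<sigma> M) = TFun \<sigma> (tyof \<Sigma> (\<sigma> # \<Gamma>) M)"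
| "tyof \<Sigma> \<Gamma> (App M N) = (case tyof \<Sigma> \<Gamma> M of TFun \<sigma> \<tau> \<Rightarrow> \<tau> | _ \<Rightarrow> TUnit)"

lemma tyof_typing: "typing \<Sigma> \<Gamma> M \<sigma> \<Longrightarrow> tyof \<Sigma> \<Gamma> M = \<sigma>"
  by (induction rule: typing.induct) simp_all

section \<open>The selection monad\<close>

text \<open>\<open>S(X) = (X \<rightarrow> R) \<rightarrow> R \<times> X\<close> for a set \<open>X\<close>, with \<open>R\<close> the whole type \<open>'r\<close>.  Functions with a given
  domain are extensional functions in the sense of \<^theory>\<open>HOL-Library.FuncSet\<close>, so that equality
  of elements of \<open>S(X)\<close> is equality in HOL.\<close>

type_synonym ('x, 'r) sel = "('x \<Rightarrow> 'r) \<Rightarrow> 'r \<times> 'x"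

definition Sel :: "'x set \<Rightarrow> ('x, 'r) sel set" where
  "Sel X = (X \<rightarrow>\<^sub>E UNIV) \<rightarrow>\<^sub>E (UNIV \<times> X)"

definition Rw :: "('x, 'r::plus) sel \<Rightarrow> ('x \<Rightarrow> 'r) \<Rightarrow> 'r" where
  "Rw F \<gamma> = (case F \<gamma> of (r, x) \<Rightarrow> r + \<gamma> x)"

definition eta :: "'x set \<Rightarrow> 'x \<Rightarrow> ('x, 'r::zero) sel" where
  "eta X x = (\<lambda>\<gamma>\<in>X \<rightarrow>\<^sub>E UNIV. (0, x))"

text \<open>\<open>bind X Y f F\<close> is the Kleisli extension of \<open>f : X \<rightarrow> S(Y)\<close>, applied to \<open>F \<in> S(X)\<close>.\<close>

definition bind ::
  "'x set \<Rightarrow> 'y set \<Rightarrow> ('x \<Rightarrow> ('y, 'r::plus) sel) \<Rightarrow> ('x, 'r) sel \<Rightarrow> ('y, 'r) sel" where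
  "bind X Y f F = (\<lambda>\<gamma>\<in>Y \<rightarrow>\<^sub>E UNIV.
     (case F (\<lambda>x'\<in>X. Rw (f x') \<gamma>) of (r, x) \<Rightarrow>
       (case f x \<gamma> of (s, y) \<Rightarrow> (r + s, y))))"

definition sel_or ::
  "'x set \<Rightarrow> ('x, 'r::{plus,ord}) sel \<Rightarrow> ('x, 'r) sel \<Rightarrow> ('x, 'r) sel" where
  "sel_or X G0 G1 = (\<lambda>\<gamma>\<in>X \<rightarrow>\<^sub>E UNIV. if Rw G0 \<gamma> \<ge> Rw G1 \<gamma> then G0 \<gamma> else G1 \<gamma>)"

definition sel_act :: "'x set \<Rightarrow> 'r::plus \<Rightarrow> ('x, 'r) sel \<Rightarrow> ('x, 'r) sel" where
  "sel_act X r G = (\<lambda>\<gamma>\<in>X \<rightarrow>\<^sub>E UNIV. (case G \<gamma> of (s, x) \<Rightarrow> (r + s, x)))"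

text \<open>Left-to-right sequencing of a list of computations \<open>F\<^sub>i \<in> S(X\<^sub>i)\<close>.\<close>

fun bind_list ::
  "('x set \<times> ('x, 'r::plus) sel) list \<Rightarrow> 'y set \<Rightarrow> ('x list \<Rightarrow> ('y, 'r) sel) \<Rightarrow> ('y, 'r) sel" where
  "bind_list [] Y k = k []"
| "bind_list ((X, F) # Fs) Y k = bind X Y (\<lambda>x. bind_list Fs Y (\<lambda>xs. k (x # xs))) F"

section \<open>Interpretations and denotational semantics\<close>

text \<open>Elements of the base sets.  \<open>'r\<close> is the set \<open>R\<close> of rewards, and \<open>'d\<close> is a supply of elements
  for the remaining base types.\<close>

datatype ('r, 'd) bval = BoolV bool | RewV 'r | OtherV 'd

record ('b, 'c, 'f, 'r, 'd) interp =
  bden :: "'b \<Rightarrow> ('r, 'd) bval set"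
  cden :: "'c \<Rightarrow> ('r, 'd) bval"
  fden :: "'f \<Rightarrow> ('r, 'd) bval list \<Rightarrow> ('r, 'd) bval"

text \<open>The compatibility of addition and order is stated directly because the cancellation classes of
  the library also demand a subtraction.\<close>

definition interp_ok ::
  "('b, 'c, 'f) signature \<Rightarrow> ('b, 'c, 'f, 'r::{comm_monoid_add,linorder}, 'd) interp \<Rightarrow> bool" where
  "interp_ok \<Sigma> I \<longleftrightarrow>
     (\<forall>r s t::'r. r \<le> s \<longleftrightarrow> r + t \<le> s + t) \<and>
     (\<forall>b. bden I b \<noteq> {}) \<and>
     bden I (boolT \<Sigma>) = range BoolV \<and>
     bden I (rewT \<Sigma>) = range RewV \<and>
     (\<forall>c. cden I c \<in> bden I (cty \<Sigma> c)) \<and>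
     cden I (ttC \<Sigma>) = BoolV True \<and> cden I (ffC \<Sigma>) = BoolV False \<and> cden I (zeroC \<Sigma>) = RewV 0 \<and>
     (\<forall>c c'. cty \<Sigma> c = cty \<Sigma> c' \<and> c \<noteq> c' \<longrightarrow> cden I c \<noteq> cden I c') \<and>
     (\<exists>c. cty \<Sigma> c = rewT \<Sigma> \<and> cden I c \<noteq> RewV 0) \<and>
     (\<forall>f vs. list_all2 (\<lambda>v b. v \<in> bden I b) vs (fargs \<Sigma> f) \<longrightarrow>
        fden I f vs \<in> bden I (fres \<Sigma> f)) \<and>
     (\<forall>r s. fden I (plusF \<Sigma>) [RewV r, RewV s] = RewV (r + s)) \<and>
     (\<forall>r s. fden I (leqF \<Sigma>) [RewV r, RewV s] = BoolV (r \<le> s)) \<and>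
     (\<forall>f cs. map (cty \<Sigma>) cs = fargs \<Sigma> f \<longrightarrow>
        fden I f (map (cden I) cs) = cden I (fval \<Sigma> f cs))"

text \<open>The sets \<open>\<S>\<lbrakk>\<sigma>\<rbrakk>\<close>, \<open>\<sigma>\<close> ranging over all types, do not fit into one HOL type.  So an element of
  \<open>\<S>\<lbrakk>\<sigma> \<rightarrow> \<tau>\<rbrakk> = (\<S>\<lbrakk>\<sigma>\<rbrakk> \<rightarrow> S(\<S>\<lbrakk>\<tau>\<rbrakk>))\<close> is represented by a code in an arbitrary type \<open>'u\<close>, by means of a
  function \<open>enc\<close> that \<open>faithful\<close> requires to be injective on that full function space, for the function
  types in a given set.\<close>

datatype ('r, 'd, 'u) val =
    BaseV "('r, 'd) bval"
  | StarV
  | PairV "('r, 'd, 'u) val" "('r, 'd, 'u) val"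
  | FunV 'u

type_synonym ('r, 'd, 'u) fn = "('r, 'd, 'u) val \<Rightarrow> (('r, 'd, 'u) val, 'r) sel"

fun tden :: "('b, 'c, 'f, 'r, 'd) interp \<Rightarrow> (('r, 'd, 'u) fn \<Rightarrow> 'u) \<Rightarrow> 'b ty \<Rightarrow> ('r, 'd, 'u) val set"
where
  "tden I enc (TBase b) = BaseV ` bden I b"
| "tden I enc TUnit = {StarV}"
| "tden I enc (TProd \<sigma> \<tau>) = (\<lambda>(v, w). PairV v w) ` (tden I enc \<sigma> \<times> tden I enc \<tau>)"
| "tden I enc (TFun \<sigma> \<tau>) = (\<lambda>g. FunV (enc g)) ` (tden I enc \<sigma> \<rightarrow>\<^sub>E Sel (tden I enc \<tau>))"

definition faithful ::
  "('b, 'c, 'f, 'r, 'd) interp \<Rightarrow> (('r, 'd, 'u) fn \<Rightarrow> 'u) \<Rightarrow> 'b ty set \<Rightarrow> bool" where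
  "faithful I enc T \<longleftrightarrow>
     (\<forall>\<sigma> \<tau>. TFun \<sigma> \<tau> \<in> T \<longrightarrow> inj_on enc (tden I enc \<sigma> \<rightarrow>\<^sub>E Sel (tden I enc \<tau>)))"

text \<open>The types occurring in a term: the types of its subterms and all types these are built from.
  This set is finite, so for every term there are a type \<open>'u\<close> and an \<open>enc\<close> that is faithful for it.\<close>

fun subtypes :: "'b ty \<Rightarrow> 'b ty set" where
  "subtypes (TBase b) = {TBase b}"
| "subtypes TUnit = {TUnit}"
| "subtypes (TProd \<sigma> \<tau>) = insert (TProd \<sigma> \<tau>) (subtypes \<sigma> \<union> subtypes \<tau>)"
| "subtypes (TFun \<sigma> \<tau>) = insert (TFun \<sigma> \<tau>) (subtypes \<sigma> \<union> subtypes \<tau>)"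

fun occ_types :: "('b, 'c, 'f) signature \<Rightarrow> 'b ty list \<Rightarrow> ('b, 'c, 'f) tm \<Rightarrow> 'b ty set" where
  "occ_types \<Sigma> \<Gamma> (Var i) = subtypes (tyof \<Sigma> \<Gamma> (Var i :: ('b, 'c, 'f) tm))"
| "occ_types \<Sigma> \<Gamma> (Const c) = subtypes (tyof \<Sigma> \<Gamma> (Const c :: ('b, 'c, 'f) tm))"
| "occ_types \<Sigma> \<Gamma> (Func f Ms) = subtypes (tyof \<Sigma> \<Gamma> (Func f Ms)) \<union> (\<Union>M\<in>set Ms. occ_types \<Sigma> \<Gamma> M)"
| "occ_types \<Sigma> \<Gamma> (Cond L M N) = subtypes (tyof \<Sigma> \<Gamma> (Cond L M N)) \<union>
     occ_types \<Sigma> \<Gamma> L \<union> occ_types \<Sigma> \<Gamma> M \<union> occ_types \<Sigma> \<Gamma> N"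
| "occ_types \<Sigma> \<Gamma> (Or M N) = subtypes (tyof \<Sigma> \<Gamma> (Or M N)) \<union> occ_types \<Sigma> \<Gamma> M \<union> occ_types \<Sigma> \<Gamma> N"
| "occ_types \<Sigma> \<Gamma> (Act N M) = subtypes (tyof \<Sigma> \<Gamma> (Act N M)) \<union> occ_types \<Sigma> \<Gamma> N \<union> occ_types \<Sigma> \<Gamma> M"
| "occ_types \<Sigma> \<Gamma> Star = subtypes (tyof \<Sigma> \<Gamma> (Star :: ('b, 'c, 'f) tm))"
| "occ_types \<Sigma> \<Gamma> (Tuple M N) =
     subtypes (tyof \<Sigma> \<Gamma> (Tuple M N)) \<union> occ_types \<Sigma> \<Gamma> M \<union> occ_types \<Sigma> \<Gamma> N"
| "occ_types \<Sigma> \<Gamma> (Fst M) = subtypes (tyof \<Sigma> \<Gamma> (Fst M)) \<union> occ_types \<Sigma> \<Gamma> M"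
| "occ_types \<Sigma> \<Gamma> (Snd M) = subtypes (tyof \<Sigma> \<Gamma> (Snd M)) \<union> occ_types \<Sigma> \<Gamma> M"
| "occ_types \<Sigma> \<Gamma> (Lam \<sigma> M) = subtypes (tyof \<Sigma> \<Gamma> (Lam \<sigma> M)) \<union> occ_types \<Sigma> (\<sigma> # \<Gamma>) M"
| "occ_types \<Sigma> \<Gamma> (App M N) = subtypes (tyof \<Sigma> \<Gamma> (App M N)) \<union> occ_types \<Sigma> \<Gamma> M \<union> occ_types \<Sigma> \<Gamma> N"

fun the_base :: "('r, 'd, 'u) val \<Rightarrow> ('r, 'd) bval" where
  "the_base (BaseV a) = a"
| "the_base _ = undefined"

fun the_rew :: "('r, 'd, 'u) val \<Rightarrow> 'r" where
  "the_rew (BaseV (RewV r)) = r"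
| "the_rew _ = undefined"

fun vfst :: "('r, 'd, 'u) val \<Rightarrow> ('r, 'd, 'u) val" where
  "vfst (PairV v w) = v"
| "vfst _ = undefined"

fun vsnd :: "('r, 'd, 'u) val \<Rightarrow> ('r, 'd, 'u) val" where
  "vsnd (PairV v w) = w"
| "vsnd _ = undefined"

text \<open>The function in \<open>\<S>\<lbrakk>\<sigma>\<rbrakk> \<rightarrow> S(\<S>\<lbrakk>\<tau>\<rbrakk>)\<close> represented by an element of \<open>\<S>\<lbrakk>\<sigma> \<rightarrow> \<tau>\<rbrakk>\<close>.\<close>

fun the_fun :: "('b, 'c, 'f, 'r, 'd) interp \<Rightarrow> (('r, 'd, 'u) fn \<Rightarrow> 'u) \<Rightarrow> 'b ty \<Rightarrow> 'b ty \<Rightarrow>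
    ('r, 'd, 'u) val \<Rightarrow> ('r, 'd, 'u) fn" where
  "the_fun I enc \<sigma> \<tau> (FunV u) =
     the_inv_into (tden I enc \<sigma> \<rightarrow>\<^sub>E Sel (tden I enc \<tau>)) enc u"
| "the_fun I enc \<sigma> \<tau> _ = undefined"

text \<open>\<open>sem \<Sigma> I enc \<Gamma> M \<rho>\<close> is \<open>\<S>\<lbrakk>M\<rbrakk>(\<rho>)\<close> for \<open>\<Gamma> \<turnstile> M : \<sigma>\<close> and \<open>\<rho> \<in> \<S>\<lbrakk>\<Gamma>\<rbrakk>\<close> (a list of values, one for each
  position of \<open>\<Gamma>\<close>).\<close>

fun sem :: "('b, 'c, 'f) signature \<Rightarrow> ('b, 'c, 'f, 'r::{comm_monoid_add,linorder}, 'd) interp \<Rightarrow>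
    (('r, 'd, 'u) fn \<Rightarrow> 'u) \<Rightarrow> 'b ty list \<Rightarrow> ('b, 'c, 'f) tm \<Rightarrow> ('r, 'd, 'u) val list \<Rightarrow>
    (('r, 'd, 'u) val, 'r) sel" where
  "sem \<Sigma> I enc \<Gamma> (Var i) \<rho> = eta (tden I enc (\<Gamma> ! i)) (\<rho> ! i)"
| "sem \<Sigma> I enc \<Gamma> (Const c) \<rho> = eta (tden I enc (TBase (cty \<Sigma> c))) (BaseV (cden I c))"
| "sem \<Sigma> I enc \<Gamma> (Func f Ms) \<rho> =
     (let Y = tden I enc (TBase (fres \<Sigma> f)) in
      bind_list (map (\<lambda>M. (tden I enc (tyof \<Sigma> \<Gamma> M), sem \<Sigma> I enc \<Gamma> M \<rho>)) Ms) Y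
        (\<lambda>vs. eta Y (BaseV (fden I f (map the_base vs)))))"
| "sem \<Sigma> I enc \<Gamma> (Cond L M N) \<rho> =
     bind (tden I enc (TBase (boolT \<Sigma>))) (tden I enc (tyof \<Sigma> \<Gamma> M))
       (\<lambda>v. if v = BaseV (BoolV True) then sem \<Sigma> I enc \<Gamma> M \<rho> else sem \<Sigma> I enc \<Gamma> N \<rho>)
       (sem \<Sigma> I enc \<Gamma> L \<rho>)"
| "sem \<Sigma> I enc \<Gamma> (Or M N) \<rho> =
     sel_or (tden I enc (tyof \<Sigma> \<Gamma> M)) (sem \<Sigma> I enc \<Gamma> M \<rho>) (sem \<Sigma> I enc \<Gamma> N \<rho>)"
| "sem \<Sigma> I enc \<Gamma> (Act N M) \<rho> =
     (let Y = tden I enc (tyof \<Sigma> \<Gamma> M) in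
      bind (tden I enc (TBase (rewT \<Sigma>))) Y
        (\<lambda>v. sel_act Y (the_rew v) (sem \<Sigma> I enc \<Gamma> M \<rho>))
        (sem \<Sigma> I enc \<Gamma> N \<rho>))"
| "sem \<Sigma> I enc \<Gamma> Star \<rho> = eta (tden I enc TUnit) StarV"
| "sem \<Sigma> I enc \<Gamma> (Tuple M N) \<rho> =
     (let \<sigma> = tyof \<Sigma> \<Gamma> M; \<tau> = tyof \<Sigma> \<Gamma> N; Y = tden I enc (TProd \<sigma> \<tau>) in
      bind (tden I enc \<sigma>) Y
        (\<lambda>v. bind (tden I enc \<tau>) Y (\<lambda>w. eta Y (PairV v w)) (sem \<Sigma> I enc \<Gamma> N \<rho>))
        (sem \<Sigma> I enc \<Gamma> M \<rho>))"
| "sem \<Sigma> I enc \<Gamma> (Fst M) \<rho> =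
     (let Y = tden I enc (tyof \<Sigma> \<Gamma> (Fst M)) in
      bind (tden I enc (tyof \<Sigma> \<Gamma> M)) Y (\<lambda>v. eta Y (vfst v)) (sem \<Sigma> I enc \<Gamma> M \<rho>))"
| "sem \<Sigma> I enc \<Gamma> (Snd M) \<rho> =
     (let Y = tden I enc (tyof \<Sigma> \<Gamma> (Snd M)) in
      bind (tden I enc (tyof \<Sigma> \<Gamma> M)) Y (\<lambda>v. eta Y (vsnd v)) (sem \<Sigma> I enc \<Gamma> M \<rho>))"
| "sem \<Sigma> I enc \<Gamma> (Lam \<sigma> M) \<rho> =
     eta (tden I enc (tyof \<Sigma> \<Gamma> (Lam \<sigma> M)))
       (FunV (enc (\<lambda>a\<in>tden I enc \<sigma>. sem \<Sigma> I enc (\<sigma> # \<Gamma>) M (a # \<rho>))))"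
| "sem \<Sigma> I enc \<Gamma> (App M N) \<rho> =
     (let \<sigma> = tyof \<Sigma> \<Gamma> N; \<tau> = tyof \<Sigma> \<Gamma> (App M N); Y = tden I enc \<tau> in
      bind (tden I enc (tyof \<Sigma> \<Gamma> M)) Y
        (\<lambda>g. bind (tden I enc \<sigma>) Y (\<lambda>a. the_fun I enc \<sigma> \<tau> g a) (sem \<Sigma> I enc \<Gamma> N \<rho>))
        (sem \<Sigma> I enc \<Gamma> M \<rho>))"

definition sem_pure :: "('b, 'c, 'f) signature \<Rightarrow>
    ('b, 'c, 'f, 'r::{comm_monoid_add,linorder}, 'd) interp \<Rightarrow> (('r, 'd, 'u) fn \<Rightarrow> 'u) \<Rightarrow>
    ('b, 'c, 'f) tm \<Rightarrow> 'b \<Rightarrow> bool" where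
  "sem_pure \<Sigma> I enc M b \<longleftrightarrow>
     (\<exists>a\<in>bden I b. sem \<Sigma> I enc [] M [] = eta (tden I enc (TBase b)) (BaseV a))"

section \<open>Equational logic\<close>

datatype ('b, 'c, 'f) assertion =
    Eqn "('b, 'c, 'f) tm" "('b, 'c, 'f) tm" "'b ty"
  | Pure "('b, 'c, 'f) tm" "'b ty"

fun lift_assertion :: "nat \<Rightarrow> ('b, 'c, 'f) assertion \<Rightarrow> ('b, 'c, 'f) assertion" where
  "lift_assertion k (Eqn M N \<sigma>) = Eqn (lift k M) (lift k N) \<sigma>"
| "lift_assertion k (Pure M \<sigma>) = Pure (lift k M) \<sigma>"

fun subst_assertion ::
  "nat \<Rightarrow> ('b, 'c, 'f) tm \<Rightarrow> ('b, 'c, 'f) assertion \<Rightarrow> ('b, 'c, 'f) assertion" where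
  "subst_assertion k V (Eqn M N \<sigma>) = Eqn (subst k V M) (subst k V N) \<sigma>"
| "subst_assertion k V (Pure M \<sigma>) = Pure (subst k V M) \<sigma>"

text \<open>\<open>let_list [(\<sigma>\<^sub>1,M\<^sub>1),...,(\<sigma>\<^sub>m,M\<^sub>m)] N\<close> is \<open>let x\<^sub>1 be M\<^sub>1 in ... let x\<^sub>m be M\<^sub>m in N\<close> with the
  \<open>x\<^sub>i\<close> not free in the \<open>M\<^sub>j\<close>; in \<open>N\<close>, the variable \<open>x\<^sub>i\<close> is index \<open>m - i\<close>.\<close>

fun let_list :: "('b ty \<times> ('b, 'c, 'f) tm) list \<Rightarrow> ('b, 'c, 'f) tm \<Rightarrow> ('b, 'c, 'f) tm" where
  "let_list [] N = N"
| "let_list ((\<sigma>, M) # ps) N = LetT \<sigma> M (let_list (map (\<lambda>(\<tau>, L). (\<tau>, lift 0 L)) ps) N)"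

text \<open>\<open>derives \<Sigma> Ax \<Gamma> A\<close>: the assertion \<open>A\<close> in context \<open>\<Gamma>\<close> is derivable from \<open>Ax\<close>, a set of assertions
  in context.  Variables of the object language that the rules mention are arbitrary indices, and
  terms moved under binders of fresh variables are lifted.\<close>

inductive derives ::
  "('b, 'c, 'f) signature \<Rightarrow> ('b ty list \<times> ('b, 'c, 'f) assertion) set \<Rightarrow> 'b ty list \<Rightarrow>
   ('b, 'c, 'f) assertion \<Rightarrow> bool"
  for \<Sigma> Ax where
  axiom: "(\<Gamma>, A) \<in> Ax \<Longrightarrow> derives \<Sigma> Ax \<Gamma> A"
  \<comment> \<open>equivalence and congruence\<close>
| refl: "typing \<Sigma> \<Gamma> M \<sigma> \<Longrightarrow> derives \<Sigma> Ax \<Gamma> (Eqn M M \<sigma>)"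
| sym: "derives \<Sigma> Ax \<Gamma> (Eqn M N \<sigma>) \<Longrightarrow> derives \<Sigma> Ax \<Gamma> (Eqn N M \<sigma>)"
| trans: "derives \<Sigma> Ax \<Gamma> (Eqn L M \<sigma>) \<Longrightarrow> derives \<Sigma> Ax \<Gamma> (Eqn M N \<sigma>) \<Longrightarrow>
    derives \<Sigma> Ax \<Gamma> (Eqn L N \<sigma>)"
| cong_Func: "length Ms = length (fargs \<Sigma> f) \<Longrightarrow> length Ns = length (fargs \<Sigma> f) \<Longrightarrow>
    (\<And>i. i < length (fargs \<Sigma> f) \<Longrightarrow>
       derives \<Sigma> Ax \<Gamma> (Eqn (Ms ! i) (Ns ! i) (TBase (fargs \<Sigma> f ! i)))) \<Longrightarrow>
    derives \<Sigma> Ax \<Gamma> (Eqn (Func f Ms) (Func f Ns) (TBase (fres \<Sigma> f)))"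
| cong_Cond: "derives \<Sigma> Ax \<Gamma> (Eqn L L' (TBase (boolT \<Sigma>))) \<Longrightarrow>
    derives \<Sigma> Ax \<Gamma> (Eqn M M' \<sigma>) \<Longrightarrow> derives \<Sigma> Ax \<Gamma> (Eqn N N' \<sigma>) \<Longrightarrow>
    derives \<Sigma> Ax \<Gamma> (Eqn (Cond L M N) (Cond L' M' N') \<sigma>)"
| cong_Or: "derives \<Sigma> Ax \<Gamma> (Eqn M M' \<sigma>) \<Longrightarrow> derives \<Sigma> Ax \<Gamma> (Eqn N N' \<sigma>) \<Longrightarrow>
    derives \<Sigma> Ax \<Gamma> (Eqn (Or M N) (Or M' N') \<sigma>)"
| cong_Act: "derives \<Sigma> Ax \<Gamma> (Eqn N N' (TBase (rewT \<Sigma>))) \<Longrightarrow> derives \<Sigma> Ax \<Gamma> (Eqn M M' \<sigma>) \<Longrightarrow>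
    derives \<Sigma> Ax \<Gamma> (Eqn (Act N M) (Act N' M') \<sigma>)"
| cong_Tuple: "derives \<Sigma> Ax \<Gamma> (Eqn M M' \<sigma>) \<Longrightarrow> derives \<Sigma> Ax \<Gamma> (Eqn N N' \<tau>) \<Longrightarrow>
    derives \<Sigma> Ax \<Gamma> (Eqn (Tuple M N) (Tuple M' N') (TProd \<sigma> \<tau>))"
| cong_Fst: "derives \<Sigma> Ax \<Gamma> (Eqn M M' (TProd \<sigma> \<tau>)) \<Longrightarrow>
    derives \<Sigma> Ax \<Gamma> (Eqn (Fst M) (Fst M') \<sigma>)"
| cong_Snd: "derives \<Sigma> Ax \<Gamma> (Eqn M M' (TProd \<sigma> \<tau>)) \<Longrightarrow>
    derives \<Sigma> Ax \<Gamma> (Eqn (Snd M) (Snd M') \<tau>)"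
| cong_Lam: "derives \<Sigma> Ax (\<sigma> # \<Gamma>) (Eqn M M' \<tau>) \<Longrightarrow>
    derives \<Sigma> Ax \<Gamma> (Eqn (Lam \<sigma> M) (Lam \<sigma> M') (TFun \<sigma> \<tau>))"
| cong_App: "derives \<Sigma> Ax \<Gamma> (Eqn M M' (TFun \<sigma> \<tau>)) \<Longrightarrow> derives \<Sigma> Ax \<Gamma> (Eqn N N' \<sigma>) \<Longrightarrow>
    derives \<Sigma> Ax \<Gamma> (Eqn (App M N) (App M' N') \<tau>)"
  \<comment> \<open>purity transfer, weakening, substitution of pure terms\<close>
| pure_eq: "derives \<Sigma> Ax \<Gamma> (Eqn M N \<sigma>) \<Longrightarrow> derives \<Sigma> Ax \<Gamma> (Pure M \<sigma>) \<Longrightarrow>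
    derives \<Sigma> Ax \<Gamma> (Pure N \<sigma>)"
| weaken: "derives \<Sigma> Ax (\<Gamma> @ \<Delta>) A \<Longrightarrow>
    derives \<Sigma> Ax (\<Gamma> @ \<sigma> # \<Delta>) (lift_assertion (length \<Gamma>) A)"
| substitution: "derives \<Sigma> Ax \<Gamma> (Pure M \<sigma>) \<Longrightarrow> derives \<Sigma> Ax (\<sigma> # \<Gamma>) A \<Longrightarrow>
    derives \<Sigma> Ax \<Gamma> (subst_assertion 0 M A)"
  \<comment> \<open>purity\<close>
| pure_Var: "typing \<Sigma> \<Gamma> (Var i) \<sigma> \<Longrightarrow> derives \<Sigma> Ax \<Gamma> (Pure (Var i) \<sigma>)"
| pure_Const: "typing \<Sigma> \<Gamma> (Const c) \<sigma> \<Longrightarrow> derives \<Sigma> Ax \<Gamma> (Pure (Const c) \<sigma>)"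
| pure_Star: "derives \<Sigma> Ax \<Gamma> (Pure Star TUnit)"
| pure_Lam: "typing \<Sigma> \<Gamma> (Lam \<sigma> M) \<tau> \<Longrightarrow> derives \<Sigma> Ax \<Gamma> (Pure (Lam \<sigma> M) \<tau>)"
| pure_Tuple: "typing \<Sigma> \<Gamma> (Tuple (Var i) (Var j)) \<sigma> \<Longrightarrow>
    derives \<Sigma> Ax \<Gamma> (Pure (Tuple (Var i) (Var j)) \<sigma>)"
| pure_Fst: "typing \<Sigma> \<Gamma> (Fst (Var i)) \<sigma> \<Longrightarrow> derives \<Sigma> Ax \<Gamma> (Pure (Fst (Var i)) \<sigma>)"
| pure_Snd: "typing \<Sigma> \<Gamma> (Snd (Var i)) \<sigma> \<Longrightarrow> derives \<Sigma> Ax \<Gamma> (Pure (Snd (Var i)) \<sigma>)"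
  \<comment> \<open>let\<close>
| let_id: "typing \<Sigma> \<Gamma> M \<sigma> \<Longrightarrow> derives \<Sigma> Ax \<Gamma> (Eqn (LetT \<sigma> M (Var 0)) M \<sigma>)"
| let_assoc: "typing \<Sigma> \<Gamma> M1 \<sigma>1 \<Longrightarrow> typing \<Sigma> (\<sigma>1 # \<Gamma>) M2 \<sigma>2 \<Longrightarrow> typing \<Sigma> (\<sigma>2 # \<Gamma>) N \<tau> \<Longrightarrow>
    derives \<Sigma> Ax \<Gamma>
      (Eqn (LetT \<sigma>2 (LetT \<sigma>1 M1 M2) N) (LetT \<sigma>1 M1 (LetT \<sigma>2 M2 (lift 1 N))) \<tau>)"
  \<comment> \<open>evaluation order\<close>
| order_App: "typing \<Sigma> \<Gamma> M (TFun \<sigma> \<tau>) \<Longrightarrow> typing \<Sigma> \<Gamma> N \<sigma> \<Longrightarrow>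
    derives \<Sigma> Ax \<Gamma>
      (Eqn (App M N) (LetT (TFun \<sigma> \<tau>) M (LetT \<sigma> (lift 0 N) (App (Var 1) (Var 0)))) \<tau>)"
| order_Tuple: "typing \<Sigma> \<Gamma> M \<sigma> \<Longrightarrow> typing \<Sigma> \<Gamma> N \<tau> \<Longrightarrow>
    derives \<Sigma> Ax \<Gamma>
      (Eqn (Tuple M N) (LetT \<sigma> M (LetT \<tau> (lift 0 N) (Tuple (Var 1) (Var 0)))) (TProd \<sigma> \<tau>))"
| order_Fst: "typing \<Sigma> \<Gamma> M (TProd \<sigma> \<tau>) \<Longrightarrow>
    derives \<Sigma> Ax \<Gamma> (Eqn (Fst M) (LetT (TProd \<sigma> \<tau>) M (Fst (Var 0))) \<sigma>)"
| order_Snd: "typing \<Sigma> \<Gamma> M (TProd \<sigma> \<tau>) \<Longrightarrow>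
    derives \<Sigma> Ax \<Gamma> (Eqn (Snd M) (LetT (TProd \<sigma> \<tau>) M (Snd (Var 0))) \<tau>)"
| order_Func: "typing \<Sigma> \<Gamma> (Func f Ms) \<sigma> \<Longrightarrow>
    derives \<Sigma> Ax \<Gamma>
      (Eqn (Func f Ms)
        (let_list (zip (map TBase (fargs \<Sigma> f)) Ms) (Func f (map Var (rev [0..<length Ms])))) \<sigma>)"
| order_Cond: "typing \<Sigma> \<Gamma> (Cond L M N) \<sigma> \<Longrightarrow>
    derives \<Sigma> Ax \<Gamma>
      (Eqn (Cond L M N)
        (LetT (TBase (boolT \<Sigma>)) L (Cond (Var 0) (lift 0 M) (lift 0 N))) \<sigma>)"
  \<comment> \<open>structural\<close>
| beta: "typing \<Sigma> (\<sigma> # \<Gamma>) M \<tau> \<Longrightarrow>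
    derives \<Sigma> Ax (\<sigma> # \<Gamma>) (Eqn (App (lift 0 (Lam \<sigma> M)) (Var 0)) M \<tau>)"
| eta: "typing \<Sigma> \<Gamma> (Var i) (TFun \<sigma> \<tau>) \<Longrightarrow>
    derives \<Sigma> Ax \<Gamma> (Eqn (Lam \<sigma> (App (lift 0 (Var i)) (Var 0))) (Var i) (TFun \<sigma> \<tau>))"
| fst_Tuple: "typing \<Sigma> \<Gamma> (Var i) \<sigma> \<Longrightarrow> typing \<Sigma> \<Gamma> (Var j) \<tau> \<Longrightarrow>
    derives \<Sigma> Ax \<Gamma> (Eqn (Fst (Tuple (Var i) (Var j))) (Var i) \<sigma>)"
| snd_Tuple: "typing \<Sigma> \<Gamma> (Var i) \<sigma> \<Longrightarrow> typing \<Sigma> \<Gamma> (Var j) \<tau> \<Longrightarrow>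
    derives \<Sigma> Ax \<Gamma> (Eqn (Snd (Tuple (Var i) (Var j))) (Var j) \<tau>)"
| surj_Tuple: "typing \<Sigma> \<Gamma> (Var i) (TProd \<sigma> \<tau>) \<Longrightarrow>
    derives \<Sigma> Ax \<Gamma> (Eqn (Tuple (Fst (Var i)) (Snd (Var i))) (Var i) (TProd \<sigma> \<tau>))"
| unit_Star: "typing \<Sigma> \<Gamma> (Var i) TUnit \<Longrightarrow> derives \<Sigma> Ax \<Gamma> (Eqn (Var i) Star TUnit)"
  \<comment> \<open>conditionals\<close>
| cond_tt: "typing \<Sigma> \<Gamma> M \<sigma> \<Longrightarrow> typing \<Sigma> \<Gamma> N \<sigma> \<Longrightarrow>
    derives \<Sigma> Ax \<Gamma> (Eqn (Cond (Const (ttC \<Sigma>)) M N) M \<sigma>)"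
| cond_ff: "typing \<Sigma> \<Gamma> M \<sigma> \<Longrightarrow> typing \<Sigma> \<Gamma> N \<sigma> \<Longrightarrow>
    derives \<Sigma> Ax \<Gamma> (Eqn (Cond (Const (ffC \<Sigma>)) M N) N \<sigma>)"
| cond_expand: "typing \<Sigma> \<Gamma> (Var u) (TFun (TBase (boolT \<Sigma>)) \<sigma>) \<Longrightarrow>
    typing \<Sigma> \<Gamma> (Var i) (TBase (boolT \<Sigma>)) \<Longrightarrow>
    derives \<Sigma> Ax \<Gamma>
      (Eqn (App (Var u) (Var i))
        (Cond (Var i) (App (Var u) (Const (ttC \<Sigma>))) (App (Var u) (Const (ffC \<Sigma>)))) \<sigma>)"
  \<comment> \<open>function symbols\<close>
| func_val: "map (cty \<Sigma>) cs = fargs \<Sigma> f \<Longrightarrow>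
    derives \<Sigma> Ax \<Gamma> (Eqn (Func f (map Const cs)) (Const (fval \<Sigma> f cs)) (TBase (fres \<Sigma> f)))"
  \<comment> \<open>algebraic operations\<close>
| alg_Or: "typing \<Sigma> \<Gamma> (Var u) (TFun \<sigma> \<tau>) \<Longrightarrow> typing \<Sigma> \<Gamma> M \<sigma> \<Longrightarrow> typing \<Sigma> \<Gamma> N \<sigma> \<Longrightarrow>
    derives \<Sigma> Ax \<Gamma> (Eqn (App (Var u) (Or M N)) (Or (App (Var u) M) (App (Var u) N)) \<tau>)"
| alg_Act: "typing \<Sigma> \<Gamma> (Var u) (TFun \<sigma> \<tau>) \<Longrightarrow> typing \<Sigma> \<Gamma> (Var y) (TBase (rewT \<Sigma>)) \<Longrightarrow>
    typing \<Sigma> \<Gamma> M \<sigma> \<Longrightarrow>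
    derives \<Sigma> Ax \<Gamma> (Eqn (App (Var u) (Act (Var y) M)) (Act (Var y) (App (Var u) M)) \<tau>)"
| order_Act: "typing \<Sigma> \<Gamma> N (TBase (rewT \<Sigma>)) \<Longrightarrow> typing \<Sigma> \<Gamma> M \<sigma> \<Longrightarrow>
    derives \<Sigma> Ax \<Gamma> (Eqn (Act N M) (LetT (TBase (rewT \<Sigma>)) N (Act (Var 0) (lift 0 M))) \<sigma>)"

text \<open>\<open>x \<ge> y\<close> abbreviates \<open>y \<le> x\<close>.\<close>

abbreviation geT ::
  "('b, 'c, 'f) signature \<Rightarrow> ('b, 'c, 'f) tm \<Rightarrow> ('b, 'c, 'f) tm \<Rightarrow> ('b, 'c, 'f) tm" where
  "geT \<Sigma> M N \<equiv> Func (leqF \<Sigma>) [N, M]"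

inductive_set selection_axioms ::
  "('b, 'c, 'f) signature \<Rightarrow> ('b ty list \<times> ('b, 'c, 'f) assertion) set"
  for \<Sigma> where
  or_assoc: "typing \<Sigma> \<Gamma> L \<sigma> \<Longrightarrow> typing \<Sigma> \<Gamma> M \<sigma> \<Longrightarrow> typing \<Sigma> \<Gamma> N \<sigma> \<Longrightarrow>
    (\<Gamma>, Eqn (Or (Or L M) N) (Or L (Or M N)) \<sigma>) \<in> selection_axioms \<Sigma>"
| or_idem: "typing \<Sigma> \<Gamma> M \<sigma> \<Longrightarrow> (\<Gamma>, Eqn (Or M M) M \<sigma>) \<in> selection_axioms \<Sigma>"
| act_zero: "typing \<Sigma> \<Gamma> N \<sigma> \<Longrightarrow> (\<Gamma>, Eqn (Act (Const (zeroC \<Sigma>)) N) N \<sigma>) \<in> selection_axioms \<Sigma>"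
| act_act: "typing \<Sigma> \<Gamma> (Var x) (TBase (rewT \<Sigma>)) \<Longrightarrow> typing \<Sigma> \<Gamma> (Var y) (TBase (rewT \<Sigma>)) \<Longrightarrow>
    typing \<Sigma> \<Gamma> N \<sigma> \<Longrightarrow>
    (\<Gamma>, Eqn (Act (Var x) (Act (Var y) N)) (Act (Func (plusF \<Sigma>) [Var x, Var y]) N) \<sigma>)
      \<in> selection_axioms \<Sigma>"
| act_or: "typing \<Sigma> \<Gamma> (Var x) (TBase (rewT \<Sigma>)) \<Longrightarrow> typing \<Sigma> \<Gamma> M \<sigma> \<Longrightarrow> typing \<Sigma> \<Gamma> N \<sigma> \<Longrightarrow>
    (\<Gamma>, Eqn (Act (Var x) (Or M N)) (Or (Act (Var x) M) (Act (Var x) N)) \<sigma>)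
      \<in> selection_axioms \<Sigma>"
| cond_or: "typing \<Sigma> \<Gamma> (Var x) (TBase (rewT \<Sigma>)) \<Longrightarrow> typing \<Sigma> \<Gamma> (Var y) (TBase (rewT \<Sigma>)) \<Longrightarrow>
    typing \<Sigma> \<Gamma> M \<sigma> \<Longrightarrow>
    (\<Gamma>, Eqn (Cond (geT \<Sigma> (Var x) (Var y)) (Act (Var x) M) (Act (Var y) M))
            (Or (Act (Var x) M) (Act (Var y) M)) \<sigma>) \<in> selection_axioms \<Sigma>"
| cond_or_or: "typing \<Sigma> \<Gamma> (Var x) (TBase (rewT \<Sigma>)) \<Longrightarrow> typing \<Sigma> \<Gamma> (Var z) (TBase (rewT \<Sigma>)) \<Longrightarrow>
    typing \<Sigma> \<Gamma> M \<sigma> \<Longrightarrow> typing \<Sigma> \<Gamma> N \<sigma> \<Longrightarrow>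
    (\<Gamma>, Eqn (Cond (geT \<Sigma> (Var x) (Var z)) (Or (Act (Var x) M) N) (Or N (Act (Var z) M)))
            (Or (Or (Act (Var x) M) N) (Act (Var z) M)) \<sigma>) \<in> selection_axioms \<Sigma>"

end

theory Submission
  imports Defs
begin

text \<open>
  A logical relation between closed terms and denotations shows that every closed term provably equals
  a finite tree of choices and rewards with values at its leaves, and that its denotation is that
  of the tree; no operational semantics is needed.  At base type the leaves are constants, and the
  axioms turn the tree into \<open>c\<^sub>1 \<cdot> v\<^sub>1 or \<dots> or c\<^sub>n \<cdot> v\<^sub>n\<close> with distinct \<open>v\<^sub>i\<close>: of two entries with the same
  value, the one with the smaller reward can be dropped.  Since some reward is not \<open>0\<close>, every entry is
  the one selected for a suitable reward continuation.  So if the denotation is \<open>\<eta>(a)\<close>, there is only one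
  entry, and its reward is \<open>0\<close>.
\<close>

section \<open>Closing substitutions\<close>

text \<open>Therefore every step carries a provable equation and the matching identity of
  denotations side by side. Most axioms speak of variables. They are used at closed terms, by
  substituting pure closed terms for these variables, so that lifting under binders has no effect.
  The rewards form only an ordered commutative monoid. A continuation cannot cancel the reward of an
  entry by subtracting it; instead it adds the rewards of all the other entries, which brings every
  entry to the same total.\<close>

inductive_cases typing_LamE: "typing \<Sigma> \<Gamma> (Lam \<sigma> M) \<tau>"

text \<open>Closedness is used only as invariance under the two de Bruijn operations, so it is
  defined as that, with no notion of free variable.\<close>

definition closed_tm :: "('b, 'c, 'f) tm \<Rightarrow> bool" where
  "closed_tm M \<longleftrightarrow> (\<forall>k V. lift k M = M \<and> subst k V M = M)"

text \<open>All free indices of a term typed in \<open>\<Gamma>\<close> lie below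
  \<open>length \<Gamma>\<close>. The bound \<open>k\<close> is left general because it grows under
  binders.\<close>

lemma typing_lift_subst_id:
  assumes "typing \<Sigma> \<Gamma> M \<sigma>" "length \<Gamma> \<le> k"
  shows "lift k M = M \<and> subst k V M = M"
  using assms
proof (induction arbitrary: k V rule: typing.induct)
  case (3 \<Gamma> Ms f b)
  then show ?case
    by (auto simp: list_all2_conv_all_nth in_set_conv_nth intro!: map_idI)
qed simp_all

lemma typing_closed_tm: "typing \<Sigma> [] M \<sigma> \<Longrightarrow> closed_tm M"
  unfolding closed_tm_def using typing_lift_subst_id[of \<Sigma> "[]" M \<sigma>] by simp

lemma subst_lift [simp]: "subst k V (lift k M) = M"
  by (induction M arbitrary: k V) (auto intro!: map_idI)

text \<open>Appending types at the outer end of a context shifts no index, so the term needs no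
  lifting. A closed term can therefore be placed in any context unchanged.\<close>

lemma typing_append: "typing \<Sigma> \<Gamma> M \<sigma> \<Longrightarrow> typing \<Sigma> (\<Gamma> @ \<Delta>) M \<sigma>"
proof (induction rule: typing.induct)
  case (3 \<Gamma> Ms f b)
  show ?case
    by (rule typing.intros(3)[OF list_all2_mono[OF "3.IH"] "3.hyps"]) simp
qed (auto intro: typing.intros simp: nth_append)

lemma typing_closed_any: "typing \<Sigma> [] M \<sigma> \<Longrightarrow> typing \<Sigma> \<Gamma> M \<sigma>"
  using typing_append[of \<Sigma> "[]"] by simp

text \<open>The terms \<open>\<theta>\<close> are meant to be closed, so they are not lifted under binders.\<close>

fun csubst :: "nat \<Rightarrow> ('b, 'c, 'f) tm list \<Rightarrow> ('b, 'c, 'f) tm \<Rightarrow> ('b, 'c, 'f) tm" where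
  "csubst k \<theta> (Var i) =
     (if i < k then Var i else if i - k < length \<theta> then \<theta> ! (i - k) else Var (i - length \<theta>))"
| "csubst k \<theta> (Const c) = Const c"
| "csubst k \<theta> (Func f Ms) = Func f (map (csubst k \<theta>) Ms)"
| "csubst k \<theta> (Cond L M N) = Cond (csubst k \<theta> L) (csubst k \<theta> M) (csubst k \<theta> N)"
| "csubst k \<theta> (Or M N) = Or (csubst k \<theta> M) (csubst k \<theta> N)"
| "csubst k \<theta> (Act N M) = Act (csubst k \<theta> N) (csubst k \<theta> M)"
| "csubst k \<theta> Star = Star"
| "csubst k \<theta> (Tuple M N) = Tuple (csubst k \<theta> M) (csubst k \<theta> N)"
| "csubst k \<theta> (Fst M) = Fst (csubst k \<theta> M)"
| "csubst k \<theta> (Snd M) = Snd (csubst k \<theta> M)"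
| "csubst k \<theta> (Lam \<sigma> M) = Lam \<sigma> (csubst (Suc k) \<theta> M)"
| "csubst k \<theta> (App M N) = App (csubst k \<theta> M) (csubst k \<theta> N)"

lemma csubst_Nil [simp]: "csubst k [] M = M"
  by (induction M arbitrary: k) (auto intro!: map_idI)

text \<open>Beta reduction yields a \<open>subst\<close> into a body in which the environment has
  already been inserted below the binder. This turns it into one environment extended by the
  argument, the form that the induction hypothesis for the body has.\<close>

lemma subst_csubst:
  assumes "closed_tm W" "\<forall>V\<in>set \<theta>. closed_tm V"
  shows "subst k W (csubst (Suc k) \<theta> M) = csubst k (W # \<theta>) M"
proof (induction M arbitrary: k)
  case (Var i)
  consider "i < k" | "i = k" | "i > k" "i - Suc k < length \<theta>" | "i > k" "length \<theta> \<le> i - Suc k"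
    by linarith
  then show ?case
  proof cases
    \<comment> \<open>The inserted term is closed, so substituting \<open>W\<close> leaves it alone.
      On the other side its position is larger by one because \<open>W\<close> heads the
      list.\<close>
    case 3
    then have "closed_tm (\<theta> ! (i - Suc k))" using assms(2) by simp
    moreover have "i - k = Suc (i - Suc k)" using 3(1) by simp
    ultimately show ?thesis using 3 by (simp add: closed_tm_def)
  qed auto
next
  case (Lam \<sigma> M)
  then show ?case using assms(1) by (simp add: closed_tm_def)
qed simp_all

lemma typing_csubst:
  assumes "typing \<Sigma> (\<Delta> @ \<Gamma>) M \<sigma>" "list_all2 (typing \<Sigma> []) \<theta> \<Gamma>"
  shows "typing \<Sigma> \<Delta> (csubst (length \<Delta>) \<theta> M) \<sigma>"
  using assms(1)
proof (induction "\<Delta> @ \<Gamma>" M \<sigma> arbitrary: \<Delta> rule: typing.induct)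
  case (1 i \<sigma>)
  then show ?case using assms(2)
    by (auto simp: nth_append list_all2_conv_all_nth intro: typing.intros(1) typing_closed_any)
next
  case (3 Ms f b)
  then show ?case
    by (auto simp: list.rel_map elim: list_all2_mono intro!: typing.intros(3))
next
  case (11 \<sigma> M \<tau>)
  from 11(2)[of "\<sigma> # \<Delta>"] show ?case by (simp add: typing.intros(11))
qed (auto intro: typing.intros)

section \<open>The selection monad\<close>

lemma SelI:
  assumes "\<And>\<gamma>. \<gamma> \<in> X \<rightarrow>\<^sub>E UNIV \<Longrightarrow> snd (F \<gamma>) \<in> X" "F \<in> extensional (X \<rightarrow>\<^sub>E UNIV)"
  shows "F \<in> Sel X"
  unfolding Sel_def using assms by (auto simp: PiE_def mem_Times_iff)

lemma Sel_snd: "F \<in> Sel X \<Longrightarrow> \<gamma> \<in> X \<rightarrow>\<^sub>E UNIV \<Longrightarrow> snd (F \<gamma>) \<in> X"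
  unfolding Sel_def by (auto simp: PiE_def Pi_def mem_Times_iff)

lemma Sel_extensional: "F \<in> Sel X \<Longrightarrow> F \<in> extensional (X \<rightarrow>\<^sub>E UNIV)"
  unfolding Sel_def by (simp add: PiE_def)

lemma Rw_eq: "Rw F \<gamma> = fst (F \<gamma>) + \<gamma> (snd (F \<gamma>))"
  by (simp add: Rw_def split_beta)

lemma eta_apply: "\<gamma> \<in> X \<rightarrow>\<^sub>E UNIV \<Longrightarrow> eta X x \<gamma> = (0, x)"
  by (simp add: eta_def)

lemma bind_apply:
  assumes "\<gamma> \<in> Y \<rightarrow>\<^sub>E UNIV"
  shows "bind X Y f F \<gamma> =
    (let p = F (\<lambda>x\<in>X. Rw (f x) \<gamma>); q = f (snd p) \<gamma> in (fst p + fst q, snd q))"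
  using assms by (simp add: bind_def split_beta Let_def)

lemma sel_or_apply:
  "\<gamma> \<in> X \<rightarrow>\<^sub>E UNIV \<Longrightarrow> sel_or X F G \<gamma> = (if Rw G \<gamma> \<le> Rw F \<gamma> then F \<gamma> else G \<gamma>)"
  by (simp add: sel_or_def)

lemma sel_act_apply:
  "\<gamma> \<in> X \<rightarrow>\<^sub>E UNIV \<Longrightarrow> sel_act X r F \<gamma> = (r + fst (F \<gamma>), snd (F \<gamma>))"
  by (simp add: sel_act_def split_beta)

lemma eta_Sel: "x \<in> X \<Longrightarrow> eta X x \<in> Sel X"
  by (rule SelI) (simp_all add: eta_apply, simp add: eta_def)

lemma sel_or_Sel: "F \<in> Sel X \<Longrightarrow> G \<in> Sel X \<Longrightarrow> sel_or X F G \<in> Sel X"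
  by (rule SelI) (simp_all add: sel_or_apply Sel_snd, simp add: sel_or_def)

lemma sel_act_Sel: "F \<in> Sel X \<Longrightarrow> sel_act X r F \<in> Sel X"
  by (rule SelI) (simp_all add: sel_act_apply Sel_snd, simp add: sel_act_def)

lemma bind_Sel:
  assumes "F \<in> Sel X" "\<And>x. x \<in> X \<Longrightarrow> f x \<in> Sel Y"
  shows "bind X Y f F \<in> Sel Y"
proof (rule SelI)
  fix \<gamma> assume \<gamma>: "\<gamma> \<in> Y \<rightarrow>\<^sub>E (UNIV :: 'b set)"
  have "snd (F (\<lambda>x\<in>X. Rw (f x) \<gamma>)) \<in> X" by (rule Sel_snd[OF assms(1)]) simp
  then show "snd (bind X Y f F \<gamma>) \<in> Y"
    using \<gamma> assms(2) by (simp add: bind_apply Let_def Sel_snd)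
qed (simp add: bind_def)

lemma Rw_bind:
  fixes F :: "('x, 'r::comm_monoid_add) sel"
  assumes "F \<in> Sel X" "\<gamma> \<in> Y \<rightarrow>\<^sub>E UNIV"
  shows "Rw (bind X Y f F) \<gamma> = Rw F (\<lambda>x\<in>X. Rw (f x) \<gamma>)"
proof -
  have "snd (F (\<lambda>x\<in>X. Rw (f x) \<gamma>)) \<in> X" by (rule Sel_snd[OF assms(1)]) simp
  then show ?thesis
    using assms(2) by (simp add: Rw_eq bind_apply Let_def add.assoc)
qed

lemma bind_eta:
  fixes f :: "'x \<Rightarrow> ('y, 'r::comm_monoid_add) sel"
  assumes "x \<in> X" "f x \<in> Sel Y"
  shows "bind X Y f (eta X x) = f x"
proof (rule extensionalityI)
  show "bind X Y f (eta X x) \<in> extensional (Y \<rightarrow>\<^sub>E UNIV)" by (simp add: bind_def)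
  show "f x \<in> extensional (Y \<rightarrow>\<^sub>E UNIV)" by (rule Sel_extensional[OF assms(2)])
  fix \<gamma> :: "'y \<Rightarrow> 'r" assume "\<gamma> \<in> Y \<rightarrow>\<^sub>E UNIV"
  then show "bind X Y f (eta X x) \<gamma> = f x \<gamma>"
    by (simp add: bind_apply Let_def eta_apply)
qed

text \<open>By \<open>Rw_bind\<close>, choosing before binding compares rewards under the
  continuation pulled back along \<open>f\<close>, and these are the rewards of the two bound
  computations. Both sides thus make the same comparison.\<close>

lemma bind_sel_or:
  fixes F G :: "('x, 'r::{comm_monoid_add, linorder}) sel"
  assumes "F \<in> Sel X" "G \<in> Sel X"
  shows "bind X Y f (sel_or X F G) = sel_or Y (bind X Y f F) (bind X Y f G)"
proof (rule extensionalityI)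
  show "bind X Y f (sel_or X F G) \<in> extensional (Y \<rightarrow>\<^sub>E UNIV)" by (simp add: bind_def)
  show "sel_or Y (bind X Y f F) (bind X Y f G) \<in> extensional (Y \<rightarrow>\<^sub>E UNIV)"
    by (simp add: sel_or_def)
  fix \<gamma> assume \<gamma>: "\<gamma> \<in> Y \<rightarrow>\<^sub>E (UNIV :: 'r set)"
  show "bind X Y f (sel_or X F G) \<gamma> = sel_or Y (bind X Y f F) (bind X Y f G) \<gamma>"
    using \<gamma> by (simp add: bind_apply sel_or_apply Rw_bind assms Let_def)
qed

lemma bind_sel_act:
  fixes F :: "('x, 'r::{comm_monoid_add, linorder}) sel"
  shows "bind X Y f (sel_act X r F) = sel_act Y r (bind X Y f F)"
proof (rule extensionalityI)
  show "bind X Y f (sel_act X r F) \<in> extensional (Y \<rightarrow>\<^sub>E UNIV)" by (simp add: bind_def)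
  show "sel_act Y r (bind X Y f F) \<in> extensional (Y \<rightarrow>\<^sub>E UNIV)" by (simp add: sel_act_def)
  fix \<gamma> assume \<gamma>: "\<gamma> \<in> Y \<rightarrow>\<^sub>E (UNIV :: 'r set)"
  show "bind X Y f (sel_act X r F) \<gamma> = sel_act Y r (bind X Y f F) \<gamma>"
    using \<gamma> by (simp add: bind_apply sel_act_apply Let_def add.assoc)
qed

text \<open>A pair consists of a reward constant and a value constant. \<open>Or\<close> has no
  unit, so the empty list has no tree and lists are kept nonempty.\<close>

fun tree_tm :: "('c \<times> 'c) list \<Rightarrow> ('b, 'c, 'f) tm" where
  "tree_tm [] = undefined"
| "tree_tm [p] = Act (Const (fst p)) (Const (snd p))"
| "tree_tm (p # q # L) = Or (Act (Const (fst p)) (Const (snd p))) (tree_tm (q # L))"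

section \<open>Terms as trees of effects over values\<close>

text \<open>\<open>T\<close> stays fixed while inductions descend to subterms, whose occurring types
  form subsets; for the theorem it is the set of types occurring in the program.\<close>

locale selection_model =
  fixes \<Sigma> :: "('b, 'c, 'f) signature"
    and I :: "('b, 'c, 'f, 'r::{comm_monoid_add,linorder}, 'd) interp"
    and enc :: "('r, 'd, 'u) fn \<Rightarrow> 'u"
    and T :: "'b ty set"
  assumes signature_ok: "signature_ok \<Sigma>"
    and interp_ok: "interp_ok \<Sigma> I"
    and faithful: "faithful I enc T"
begin

abbreviation den :: "'b ty \<Rightarrow> ('r, 'd, 'u) val set" where
  "den \<equiv> tden I enc"

abbreviation eqv :: "('b, 'c, 'f) tm \<Rightarrow> ('b, 'c, 'f) tm \<Rightarrow> 'b ty \<Rightarrow> bool" where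
  "eqv M N \<sigma> \<equiv> derives \<Sigma> (selection_axioms \<Sigma>) [] (Eqn M N \<sigma>)"

abbreviation pure_tm :: "('b, 'c, 'f) tm \<Rightarrow> 'b ty \<Rightarrow> bool" where
  "pure_tm M \<sigma> \<equiv> derives \<Sigma> (selection_axioms \<Sigma>) [] (Pure M \<sigma>)"

abbreviation tyd :: "('b, 'c, 'f) tm \<Rightarrow> 'b ty \<Rightarrow> bool" where
  "tyd \<equiv> typing \<Sigma> []"

section \<open>Facts about the signature and the interpretation\<close>

lemma cden_bden: "cden I c \<in> bden I (cty \<Sigma> c)"
  using interp_ok unfolding interp_ok_def by blast

lemma cden_inj: "cty \<Sigma> c = cty \<Sigma> c' \<Longrightarrow> cden I c = cden I c' \<Longrightarrow> c = c'"
  using interp_ok unfolding interp_ok_def by blast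

lemma bden_bool: "bden I (boolT \<Sigma>) = range BoolV"
  using interp_ok unfolding interp_ok_def by blast

lemma bden_rew: "bden I (rewT \<Sigma>) = range RewV"
  using interp_ok unfolding interp_ok_def by blast

lemma cden_tt: "cden I (ttC \<Sigma>) = BoolV True" and cden_ff: "cden I (ffC \<Sigma>) = BoolV False"
  and cden_zero: "cden I (zeroC \<Sigma>) = RewV 0"
  using interp_ok unfolding interp_ok_def by blast+

lemma cty_tt: "cty \<Sigma> (ttC \<Sigma>) = boolT \<Sigma>" and cty_ff: "cty \<Sigma> (ffC \<Sigma>) = boolT \<Sigma>"
  and cty_zero: "cty \<Sigma> (zeroC \<Sigma>) = rewT \<Sigma>"
  using signature_ok unfolding signature_ok_def by blast+

lemma fden_bden:
  "list_all2 (\<lambda>v b. v \<in> bden I b) vs (fargs \<Sigma> f) \<Longrightarrow> fden I f vs \<in> bden I (fres \<Sigma> f)"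
  using interp_ok unfolding interp_ok_def by blast

lemma fden_cden:
  "map (cty \<Sigma>) cs = fargs \<Sigma> f \<Longrightarrow> fden I f (map (cden I) cs) = cden I (fval \<Sigma> f cs)"
  using interp_ok unfolding interp_ok_def by blast

lemma cty_fval: "map (cty \<Sigma>) cs = fargs \<Sigma> f \<Longrightarrow> cty \<Sigma> (fval \<Sigma> f cs) = fres \<Sigma> f"
  using signature_ok unfolding signature_ok_def by blast

lemma cden_rew: "cty \<Sigma> c = rewT \<Sigma> \<Longrightarrow> \<exists>r. cden I c = RewV r"
  using cden_bden[of c] by (auto simp: bden_rew)

text \<open>\<open>Bool\<close> has two elements, both denoted by constants, and distinct constants
  of one type have distinct denotations. So a conditional on a boolean constant can always be
  resolved by an axiom.\<close>

lemma bool_const: "cty \<Sigma> c = boolT \<Sigma> \<Longrightarrow> c = ttC \<Sigma> \<or> c = ffC \<Sigma>"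
  using cden_bden[of c] cden_inj[of c "ttC \<Sigma>"] cden_inj[of c "ffC \<Sigma>"]
  by (auto simp: bden_bool cden_tt cden_ff cty_tt cty_ff) (metis (full_types))

lemma enc_inj: "TFun \<sigma> \<tau> \<in> T \<Longrightarrow> inj_on enc (den \<sigma> \<rightarrow>\<^sub>E Sel (den \<tau>))"
  using faithful unfolding faithful_def by blast

text \<open>The only place where injectivity of \<open>enc\<close> is used: a coded function can be
  recovered at the function types in \<open>T\<close>.\<close>

lemma the_fun_FunV:
  "TFun \<sigma> \<tau> \<in> T \<Longrightarrow> g \<in> den \<sigma> \<rightarrow>\<^sub>E Sel (den \<tau>) \<Longrightarrow> the_fun I enc \<sigma> \<tau> (FunV (enc g)) = g"
  by (simp add: the_inv_into_f_f enc_inj)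

lemma the_fun_Sel:
  assumes "TFun \<sigma> \<tau> \<in> T" "v \<in> den (TFun \<sigma> \<tau>)" "w \<in> den \<sigma>"
  shows "the_fun I enc \<sigma> \<tau> v w \<in> Sel (den \<tau>)"
proof -
  obtain g where g: "g \<in> den \<sigma> \<rightarrow>\<^sub>E Sel (den \<tau>)" "v = FunV (enc g)" using assms(2) by auto
  then have "the_fun I enc \<sigma> \<tau> v = g" using the_fun_FunV assms(1) by blast
  then show ?thesis using g(1) assms(3) by (auto simp: PiE_def)
qed

section \<open>Denotations lie in the selection monad\<close>

lemma subtypes_refl: "\<sigma> \<in> subtypes \<sigma>"
  by (cases \<sigma>) auto

lemma occ_types_tyof: "tyof \<Sigma> \<Gamma> M \<in> occ_types \<Sigma> \<Gamma> M"
  by (cases M) (use subtypes_refl in auto)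

lemma occ_types_typing: "typing \<Sigma> \<Gamma> M \<sigma> \<Longrightarrow> \<sigma> \<in> occ_types \<Sigma> \<Gamma> M"
  using occ_types_tyof[of \<Gamma> M] tyof_typing by fastforce

lemma bind_list_Sel:
  assumes "list_all2 (\<lambda>(X, F) b. X = BaseV ` bden I b \<and> F \<in> Sel X) Fs bs"
    and "\<And>vs. list_all2 (\<lambda>v b. v \<in> BaseV ` bden I b) vs bs \<Longrightarrow> k vs \<in> Sel Y"
  shows "bind_list Fs Y k \<in> Sel Y"
  using assms
proof (induction Fs bs arbitrary: k rule: list_all2_induct)
  case (Cons p Fs b bs)
  obtain X F where [simp]: "p = (X, F)" by (cases p)
  show ?case using Cons by (auto intro!: bind_Sel Cons.IH)
qed simp

text \<open>The logical relation says nothing about elements to which no closed value is related,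
  such as base elements without a constant. An abstraction, however, must map all of
  \<open>den \<sigma>\<close> into \<open>Sel (den \<tau>)\<close> before its code can be decoded.
  Hence a separate induction over arbitrary environments.\<close>

lemma sem_Sel:
  assumes "typing \<Sigma> \<Gamma> M \<sigma>" "occ_types \<Sigma> \<Gamma> M \<subseteq> T" "list_all2 (\<lambda>v \<sigma>. v \<in> den \<sigma>) \<rho> \<Gamma>"
  shows "sem \<Sigma> I enc \<Gamma> M \<rho> \<in> Sel (den \<sigma>)"
  using assms
proof (induction arbitrary: \<rho> rule: typing.induct)
  case (1 i \<Gamma> \<sigma>)
  then show ?case by (auto simp: list_all2_conv_all_nth intro!: eta_Sel)
next
  case (2 c b \<Gamma>)
  then show ?case using cden_bden by (auto intro!: eta_Sel)
next
  case (3 \<Gamma> Ms f b)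
  have "list_all2 (\<lambda>(X, F) b. X = BaseV ` bden I b \<and> F \<in> Sel X)
      (map (\<lambda>M. (den (tyof \<Sigma> \<Gamma> M), sem \<Sigma> I enc \<Gamma> M \<rho>)) Ms) (fargs \<Sigma> f)"
    using 3 by (fastforce simp: list_all2_conv_all_nth tyof_typing)
  then show ?case
    unfolding sem.simps Let_def 3(2)[symmetric]
  proof (rule bind_list_Sel)
    fix vs :: "('r, 'd, 'u) val list"
    assume "list_all2 (\<lambda>v b. v \<in> BaseV ` bden I b) vs (fargs \<Sigma> f)"
    then have "list_all2 (\<lambda>v b. v \<in> bden I b) (map the_base vs) (fargs \<Sigma> f)"
      by (auto simp: list.rel_map elim: list_all2_mono)
    from fden_bden[OF this]
    show "eta (den (TBase (fres \<Sigma> f))) (BaseV (fden I f (map the_base vs)))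
        \<in> Sel (den (TBase (fres \<Sigma> f)))"
      by (auto intro: eta_Sel)
  qed
next
  case (4 \<Gamma> L M \<sigma> N)
  then show ?case by (auto simp: tyof_typing intro!: bind_Sel)
next
  case (5 \<Gamma> M \<sigma> N)
  then show ?case by (auto simp: tyof_typing intro!: sel_or_Sel)
next
  case (6 \<Gamma> N M \<sigma>)
  then show ?case by (auto simp: tyof_typing Let_def intro!: bind_Sel sel_act_Sel)
next
  case (7 \<Gamma>)
  then show ?case by (auto intro!: eta_Sel)
next
  case (8 \<Gamma> M \<sigma> N \<tau>)
  then show ?case by (auto simp: tyof_typing Let_def intro!: bind_Sel eta_Sel)
next
  case (9 \<Gamma> M \<sigma> \<tau>)
  have "vfst v \<in> den \<sigma>" if "v \<in> den (TProd \<sigma> \<tau>)" for v using that by auto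
  with 9 show ?case
    by (auto simp: tyof_typing[OF 9(1)] Let_def simp del: tden.simps
        intro!: bind_Sel[of _ "den (TProd \<sigma> \<tau>)"] eta_Sel)
next
  case (10 \<Gamma> M \<sigma> \<tau>)
  have "vsnd v \<in> den \<tau>" if "v \<in> den (TProd \<sigma> \<tau>)" for v using that by auto
  with 10 show ?case
    by (auto simp: tyof_typing[OF 10(1)] Let_def simp del: tden.simps
        intro!: bind_Sel[of _ "den (TProd \<sigma> \<tau>)"] eta_Sel)
next
  case (11 \<sigma> \<Gamma> M \<tau>)
  then have "(\<lambda>a\<in>den \<sigma>. sem \<Sigma> I enc (\<sigma> # \<Gamma>) M (a # \<rho>)) \<in> den \<sigma> \<rightarrow>\<^sub>E Sel (den \<tau>)" by auto
  then show ?case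
    using 11(1) by (auto simp: tyof_typing intro!: eta_Sel)
next
  case (12 \<Gamma> M \<sigma> \<tau> N)
  have "TFun \<sigma> \<tau> \<in> T" using occ_types_typing[OF 12(1)] 12(5) by auto
  with 12 show ?case
    by (auto simp: tyof_typing[OF 12(1)] tyof_typing[OF 12(2)] Let_def simp del: tden.simps
        intro!: bind_Sel[of _ "den (TFun \<sigma> \<tau>)"] bind_Sel[of _ "den \<sigma>"] the_fun_Sel)
qed

subsection \<open>Derived equations between closed terms\<close>

lemma tyd_closed: "tyd M \<sigma> \<Longrightarrow> lift k M = M \<and> subst k V M = M"
  using typing_closed_tm closed_tm_def by metis

text \<open>The beta axiom applies an abstraction to a variable only; the substitution rule puts a
  pure term in its place.\<close>

lemma beta_pure:
  assumes "typing \<Sigma> [\<sigma>] N \<tau>" "pure_tm V \<sigma>"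
  shows "eqv (LetT \<sigma> V N) (subst 0 V N) \<tau>"
  using derives.substitution[OF assms(2) derives.beta[OF assms(1)]]
  \<comment> \<open>With \<open>lift 0 (Lam \<sigma> N)\<close> kept folded,
    \<open>subst_lift\<close> cancels the lift.\<close>
  by (simp del: lift.simps)

lemma pure_weaken:
  "derives \<Sigma> Ax \<Gamma> (Pure V \<sigma>) \<Longrightarrow> derives \<Sigma> Ax (\<tau> # \<Gamma>) (Pure (lift 0 V) \<sigma>)"
  using derives.weaken[of \<Sigma> Ax "[]" \<Gamma> "Pure V \<sigma>" \<tau>] by simp

text \<open>A \<open>let\<close> is an applied abstraction and abstractions are pure, so the
  abstraction may replace the function variable in the algebraicity axiom.\<close>

lemma let_or:
  assumes "typing \<Sigma> [\<sigma>] N \<tau>" "tyd M1 \<sigma>" "tyd M2 \<sigma>"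
  shows "eqv (LetT \<sigma> (Or M1 M2) N) (Or (LetT \<sigma> M1 N) (LetT \<sigma> M2 N)) \<tau>"
proof -
  have "derives \<Sigma> (selection_axioms \<Sigma>) [TFun \<sigma> \<tau>]
      (Eqn (App (Var 0) (Or M1 M2)) (Or (App (Var 0) M1) (App (Var 0) M2)) \<tau>)"
    by (rule derives.alg_Or[of _ _ _ \<sigma>]) (simp_all add: assms typing_closed_any typing.intros)
  moreover have "pure_tm (Lam \<sigma> N) (TFun \<sigma> \<tau>)"
    by (intro derives.pure_Lam typing.intros assms)
  ultimately show ?thesis
    using derives.substitution tyd_closed[OF assms(2)] tyd_closed[OF assms(3)] by fastforce
qed

lemma let_act:
  assumes "typing \<Sigma> [\<sigma>] N \<tau>" "tyd M \<sigma>" "cty \<Sigma> c = rewT \<Sigma>"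
  shows "eqv (LetT \<sigma> (Act (Const c) M) N) (Act (Const c) (LetT \<sigma> M N)) \<tau>"
proof -
  let ?R = "TBase (rewT \<Sigma>)"
  have 1: "derives \<Sigma> (selection_axioms \<Sigma>) [TFun \<sigma> \<tau>, ?R]
      (Eqn (App (Var 0) (Act (Var 1) M)) (Act (Var 1) (App (Var 0) M)) \<tau>)"
    by (rule derives.alg_Act[of _ _ _ \<sigma>]) (simp_all add: assms typing_closed_any typing.intros)
  have "pure_tm (Lam \<sigma> N) (TFun \<sigma> \<tau>)"
    by (intro derives.pure_Lam typing.intros assms)
  then have 2: "derives \<Sigma> (selection_axioms \<Sigma>) [?R] (Pure (Lam \<sigma> N) (TFun \<sigma> \<tau>))"
    using pure_weaken tyd_closed[OF typing.intros(11)[OF assms(1)]] by metis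
  have 3: "pure_tm (Const c) ?R" by (intro derives.pure_Const typing.intros assms)
  have 4: "subst (Suc 0) (Const c) N = N"
    using typing_lift_subst_id[OF assms(1), of 1] by simp
  from derives.substitution[OF 3 derives.substitution[OF 2 1]]
  show ?thesis
    using 4 tyd_closed[OF assms(2)] tyd_closed[OF typing.intros(11)[OF assms(1)]] by simp
qed

text \<open>\<open>V\<close> goes in first, while the variable of type \<open>\<tau>\<close> is
  still in the context, so its purity has to be weakened; being closed, it is not changed by the
  lift.\<close>

lemma subst_const_twice:
  assumes "derives \<Sigma> (selection_axioms \<Sigma>) [\<sigma>, \<tau>] A" "pure_tm V \<sigma>" "pure_tm W \<tau>" "tyd V \<sigma>"
  shows "derives \<Sigma> (selection_axioms \<Sigma>) [] (subst_assertion 0 W (subst_assertion 0 V A))"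
  using derives.substitution[OF assms(3) derives.substitution[OF _ assms(1)]]
    pure_weaken[OF assms(2), of \<tau>] tyd_closed[OF assms(4)] by simp

lemma pure_Tuple_pure:
  assumes "pure_tm V \<sigma>" "pure_tm W \<tau>" "tyd V \<sigma>"
  shows "pure_tm (Tuple V W) (TProd \<sigma> \<tau>)"
proof -
  have "derives \<Sigma> (selection_axioms \<Sigma>) [\<sigma>, \<tau>] (Pure (Tuple (Var 0) (Var 1)) (TProd \<sigma> \<tau>))"
    by (intro derives.pure_Tuple typing.intros) simp_all
  from subst_const_twice[OF this assms] show ?thesis using tyd_closed[OF assms(3)] by simp
qed

lemma fst_Tuple_pure:
  assumes "pure_tm V \<sigma>" "pure_tm W \<tau>" "tyd V \<sigma>"
  shows "eqv (Fst (Tuple V W)) V \<sigma>"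
proof -
  have "derives \<Sigma> (selection_axioms \<Sigma>) [\<sigma>, \<tau>] (Eqn (Fst (Tuple (Var 0) (Var 1))) (Var 0) \<sigma>)"
    by (rule derives.fst_Tuple[of _ _ _ _ _ \<tau>]; rule typing.intros; simp)
  from subst_const_twice[OF this assms] show ?thesis using tyd_closed[OF assms(3)] by simp
qed

lemma snd_Tuple_pure:
  assumes "pure_tm V \<sigma>" "pure_tm W \<tau>" "tyd V \<sigma>"
  shows "eqv (Snd (Tuple V W)) W \<tau>"
proof -
  have "derives \<Sigma> (selection_axioms \<Sigma>) [\<sigma>, \<tau>] (Eqn (Snd (Tuple (Var 0) (Var 1))) (Var 1) \<tau>)"
    by (rule derives.snd_Tuple[of _ _ _ \<sigma>]; rule typing.intros; simp)
  from subst_const_twice[OF this assms] show ?thesis using tyd_closed[OF assms(3)] by simp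
qed

subsection \<open>The logical relation\<close>

text \<open>\<open>erel P \<tau> M F\<close>: the closed term \<open>M\<close> provably equals a tree of choices and rewards whose leaves
  are values related by \<open>P\<close> to elements of \<open>\<S>\<lbrakk>\<tau>\<rbrakk>\<close>, and \<open>F\<close> is the denotation of the tree of these
  elements.\<close>

inductive erel :: "(('b, 'c, 'f) tm \<Rightarrow> ('r, 'd, 'u) val \<Rightarrow> bool) \<Rightarrow> 'b ty \<Rightarrow>
    ('b, 'c, 'f) tm \<Rightarrow> (('r, 'd, 'u) val, 'r) sel \<Rightarrow> bool"
  for P \<tau> where
  leaf: "tyd M \<tau> \<Longrightarrow> eqv M V \<tau> \<Longrightarrow> P V v \<Longrightarrow> v \<in> den \<tau> \<Longrightarrow> erel P \<tau> M (eta (den \<tau>) v)"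
| choice: "tyd L \<tau> \<Longrightarrow> eqv L (Or M N) \<tau> \<Longrightarrow> erel P \<tau> M F \<Longrightarrow> erel P \<tau> N G \<Longrightarrow>
    erel P \<tau> L (sel_or (den \<tau>) F G)"
| reward: "tyd L \<tau> \<Longrightarrow> eqv L (Act (Const c) M) \<tau> \<Longrightarrow> cty \<Sigma> c = rewT \<Sigma> \<Longrightarrow> cden I c = RewV r \<Longrightarrow>
    erel P \<tau> M F \<Longrightarrow> erel P \<tau> L (sel_act (den \<tau>) r F)"

text \<open>At a function type the relation is needed at the result type inside \<open>erel\<close>.
  Having the leaf relation as the parameter \<open>P\<close> of \<open>erel\<close> separates the
  two, so \<open>vrel\<close> is a recursion on types and \<open>erel\<close> an inductive
  definition. The syntactic form required at each type makes related terms pure.\<close>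

primrec vrel :: "'b ty \<Rightarrow> ('b, 'c, 'f) tm \<Rightarrow> ('r, 'd, 'u) val \<Rightarrow> bool" where
  "vrel (TBase b) M v \<longleftrightarrow> (\<exists>c. cty \<Sigma> c = b \<and> M = Const c \<and> v = BaseV (cden I c))"
| "vrel TUnit M v \<longleftrightarrow> M = Star \<and> v = StarV"
| "vrel (TProd \<sigma> \<tau>) M v \<longleftrightarrow>
     (\<exists>V W x y. M = Tuple V W \<and> v = PairV x y \<and> vrel \<sigma> V x \<and> vrel \<tau> W y)"
| "vrel (TFun \<sigma> \<tau>) M v \<longleftrightarrow>
     (\<exists>N. M = Lam \<sigma> N) \<and> tyd M (TFun \<sigma> \<tau>) \<and> v \<in> den (TFun \<sigma> \<tau>) \<and>
     (\<forall>V x. vrel \<sigma> V x \<longrightarrow> erel (vrel \<tau>) \<tau> (App M V) (the_fun I enc \<sigma> \<tau> v x))"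

abbreviation rel :: "'b ty \<Rightarrow> ('b, 'c, 'f) tm \<Rightarrow> (('r, 'd, 'u) val, 'r) sel \<Rightarrow> bool" where
  "rel \<tau> \<equiv> erel (vrel \<tau>) \<tau>"

lemma vrel_tyd: "vrel \<sigma> V v \<Longrightarrow> tyd V \<sigma>"
  by (induction \<sigma> arbitrary: V v) (auto intro: typing.intros)

lemma vrel_den: "vrel \<sigma> V v \<Longrightarrow> v \<in> den \<sigma>"
proof (induction \<sigma> arbitrary: V v)
  case (TProd \<sigma> \<tau>)
  then show ?case by fastforce
qed (use cden_bden in auto)

lemma vrel_pure: "vrel \<sigma> V v \<Longrightarrow> pure_tm V \<sigma>"
proof (induction \<sigma> arbitrary: V v)
  case (TProd \<sigma> \<tau>)
  then obtain V1 V2 x y where "V = Tuple V1 V2" "vrel \<sigma> V1 x" "vrel \<tau> V2 y" by auto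
  with TProd.IH vrel_tyd show ?case by (simp add: pure_Tuple_pure)
next
  case (TFun \<sigma> \<tau>)
  then show ?case by (auto intro: derives.pure_Lam)
qed (auto intro: derives.pure_Const derives.pure_Star typing.intros)

lemma erel_tyd: "erel P \<tau> M F \<Longrightarrow> tyd M \<tau>"
  by (auto elim: erel.cases)

lemma erel_Sel: "erel P \<tau> M F \<Longrightarrow> F \<in> Sel (den \<tau>)"
  by (induction rule: erel.induct) (auto intro: eta_Sel sel_or_Sel sel_act_Sel)

text \<open>Each rule of \<open>erel\<close> asks for its outermost form only up to provable
  equality, so one more equation in front is absorbed by transitivity, without induction.\<close>

lemma erel_eqv:
  assumes "erel P \<tau> N F" "eqv M N \<tau>" "tyd M \<tau>"
  shows "erel P \<tau> M F"
  using assms(1)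
proof cases
  case (leaf V v)
  then show ?thesis using erel.leaf[OF assms(3) derives.trans[OF assms(2)]] by simp
next
  case (choice M1 M2 F G)
  then show ?thesis using erel.choice[OF assms(3) derives.trans[OF assms(2)]] by simp
next
  case (reward c M' r F)
  then show ?thesis using erel.reward[OF assms(3) derives.trans[OF assms(2)]] by simp
qed

lemma vrel_rel: "vrel \<tau> V v \<Longrightarrow> rel \<tau> V (eta (den \<tau>) v)"
  by (intro erel.leaf[of V \<tau> V] derives.refl vrel_tyd vrel_den)

text \<open>Syntax and semantics distribute over the tree of \<open>M\<close> in the same way:
  \<open>let_or\<close> matches \<open>bind_sel_or\<close>, \<open>let_act\<close> matches
  \<open>bind_sel_act\<close>, and at a leaf \<open>beta_pure\<close> matches
  \<open>bind_eta\<close>. The tree of \<open>M\<close> is thus grafted with the trees that the body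
  has at its leaves.\<close>

lemma rel_let:
  assumes "rel \<sigma> M F" "typing \<Sigma> [\<sigma>] N \<tau>"
    and "\<And>V v. vrel \<sigma> V v \<Longrightarrow> rel \<tau> (subst 0 V N) (f v)"
  shows "rel \<tau> (LetT \<sigma> M N) (bind (den \<sigma>) (den \<tau>) f F)"
  using assms(1)
proof (induction rule: erel.induct)
  have cong: "eqv (LetT \<sigma> M N) (LetT \<sigma> M' N) \<tau>" if "eqv M M' \<sigma>" for M M'
    by (rule derives.cong_App[OF derives.refl[OF typing.intros(11)[OF assms(2)]] that])
  have tyd: "tyd (LetT \<sigma> M N) \<tau>" if "tyd M \<sigma>" for M
    by (rule typing.intros(12)[OF typing.intros(11)[OF assms(2)] that])
  {
    case (leaf M V v)
    have "eqv (LetT \<sigma> M N) (subst 0 V N) \<tau>"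
      by (rule derives.trans[OF cong[OF leaf(2)] beta_pure[OF assms(2) vrel_pure[OF leaf(3)]]])
    from erel_eqv[OF assms(3)[OF leaf(3)] this tyd[OF leaf(1)]]
    have "rel \<tau> (LetT \<sigma> M N) (f v)" .
    with leaf show ?case by (simp add: bind_eta erel_Sel[OF assms(3)])
  next
    case (choice L M1 M2 F G)
    have "eqv (LetT \<sigma> L N) (Or (LetT \<sigma> M1 N) (LetT \<sigma> M2 N)) \<tau>"
      by (rule derives.trans[OF cong[OF choice(2)] let_or[OF assms(2) choice(3,4)[THEN erel_tyd]]])
    from erel.choice[OF tyd[OF choice(1)] this choice.IH]
    have "rel \<tau> (LetT \<sigma> L N)
        (sel_or (den \<tau>) (bind (den \<sigma>) (den \<tau>) f F) (bind (den \<sigma>) (den \<tau>) f G))" .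
    with choice show ?case by (simp add: bind_sel_or erel_Sel)
  next
    case (reward L c M r F)
    have "eqv (LetT \<sigma> L N) (Act (Const c) (LetT \<sigma> M N)) \<tau>"
      by (rule derives.trans[OF cong[OF reward(2)]
            let_act[OF assms(2) erel_tyd[OF reward(5)] reward(3)]])
    from erel.reward[OF tyd[OF reward(1)] this reward(3,4) reward.IH]
    have "rel \<tau> (LetT \<sigma> L N) (sel_act (den \<tau>) r (bind (den \<sigma>) (den \<tau>) f F))"
.
    then show ?case by (simp add: bind_sel_act)
  }
qed

declare vrel.simps [simp del]

subsection \<open>The fundamental lemma\<close>

lemma zip_lift_id:
  assumes "list_all2 (\<lambda>M b. tyd M (TBase b)) Ms bs"
  shows "map (\<lambda>(\<tau>, L). (\<tau>, lift 0 L)) (zip (map TBase bs) Ms) = zip (map TBase bs) Ms"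
  using assms by (induction rule: list_all2_induct) (simp_all add: tyd_closed)

text \<open>In \<open>let_list\<close> the variable bound last is index 0, hence the reversed list
  of types.\<close>

lemma typing_let_list:
  assumes "list_all2 (\<lambda>M b. tyd M (TBase b)) Ms bs" "typing \<Sigma> (rev (map TBase bs) @ \<Delta>) N \<tau>"
  shows "typing \<Sigma> \<Delta> (let_list (zip (map TBase bs) Ms) N) \<tau>"
  using assms
proof (induction arbitrary: \<Delta> rule: list_all2_induct)
  case (Cons M Ms b bs)
  have "typing \<Sigma> (TBase b # \<Delta>) (let_list (zip (map TBase bs) Ms) N) \<tau>"
    using Cons by simp
  then show ?case
    using zip_lift_id[OF Cons(2)]
    by (auto intro!: typing.intros(12)[OF typing.intros(11)] typing_closed_any[OF Cons(1)])
qed simp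

lemma subst_let_list:
  assumes "list_all2 (\<lambda>M b. tyd M (TBase b)) Ms bs" "tyd W \<sigma>"
  shows "subst k W (let_list (zip (map TBase bs) Ms) N) =
    let_list (zip (map TBase bs) Ms) (subst (k + length Ms) W N)"
  using assms
proof (induction arbitrary: k rule: list_all2_induct)
  case (Cons M Ms b bs)
  then show ?case
    using zip_lift_id[OF Cons(2)] by (simp add: tyd_closed)
qed simp

text \<open>The arguments evaluated so far are the constants \<open>cs\<close>.\<close>

lemma rel_let_list:
  assumes "map (cty \<Sigma>) cs @ bs = fargs \<Sigma> f"
    and "list_all2 (\<lambda>(M, X, F) b. X = den (TBase b) \<and> rel (TBase b) M F) (zip Ms Fs) bs"
    and "length Ms = length bs" "length Fs = length bs" "Y = den (TBase (fres \<Sigma> f))"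
  shows "rel (TBase (fres \<Sigma> f))
    (let_list (zip (map TBase bs) Ms) (Func f (map Const cs @ map Var (rev [0..<length Ms]))))
    (bind_list Fs Y (\<lambda>vs. eta Y (BaseV (fden I f (map (cden I) cs @ map the_base vs)))))"
  using assms
proof (induction bs arbitrary: cs Ms Fs)
  case Nil
  then have cs: "map (cty \<Sigma>) cs = fargs \<Sigma> f" by simp
  have "tyd (Func f (map Const cs)) (TBase (fres \<Sigma> f))"
    by (rule typing.intros(3))
      (auto simp: cs[symmetric] list.rel_map intro!: list.rel_refl_strong typing.intros)
  moreover have "vrel (TBase (fres \<Sigma> f)) (Const (fval \<Sigma> f cs)) (BaseV (cden I (fval \<Sigma> f cs)))"
    using cty_fval[OF cs] by (simp add: vrel.simps)
  ultimately have "rel (TBase (fres \<Sigma> f)) (Func f (map Const cs))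
      (eta Y (BaseV (cden I (fval \<Sigma> f cs))))"
    using erel_eqv[OF vrel_rel derives.func_val[OF cs]] Nil(5) by simp
  then show ?case using Nil fden_cden[OF cs] by simp
next
  case (Cons b bs)
  then obtain M Ms' X F Fs' where [simp]: "Ms = M # Ms'" "Fs = (X, F) # Fs'"
    by (auto simp: length_Suc_conv)
  have M: "rel (TBase b) M F" and X: "X = den (TBase b)"
    and rest: "list_all2 (\<lambda>(M, X, F) b. X = den (TBase b) \<and> rel (TBase b) M F) (zip Ms' Fs') bs"
    using Cons.prems by (auto)
  have len: "length Ms' = length bs" "length Fs' = length bs" using Cons.prems by auto
  have tydMs: "list_all2 (\<lambda>M b. tyd M (TBase b)) Ms' bs"
  proof (rule list_all2_all_nthI)
    fix i assume "i < length Ms'"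
    then show "tyd (Ms' ! i) (TBase (bs ! i))"
      using list_all2_nthD[OF rest, of i] len erel_tyd by (auto split: prod.splits)
  qed (rule len)
  let ?n = "length bs"
  let ?N = "Func f (map Const cs @ map Var (rev [0..<Suc ?n]))"
  have "typing \<Sigma> (rev (map TBase bs) @ [TBase b]) ?N (TBase (fres \<Sigma> f))"
  proof (rule typing.intros(3)[OF _ HOL.refl])
    have "list_all2 (\<lambda>M b'. typing \<Sigma> (rev (map TBase bs) @ [TBase b]) M (TBase b'))
        (map Var (rev [0..<Suc ?n])) (b # bs)"
      by (auto simp: list_all2_conv_all_nth rev_nth nth_append nth_Cons split: nat.split
          intro!: typing.intros(1) simp del: upt_Suc)
    moreover have "list_all2 (\<lambda>M b'. typing \<Sigma> (rev (map TBase bs) @ [TBase b]) M (TBase b'))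
        (map Const cs) (map (cty \<Sigma>) cs)"
      by (auto simp: list.rel_map intro!: list.rel_refl_strong typing.intros)
    ultimately show "list_all2 (\<lambda>M b'. typing \<Sigma> (rev (map TBase bs) @ [TBase b]) M (TBase b'))
        (map Const cs @ map Var (rev [0..<Suc ?n])) (fargs \<Sigma> f)"
      using Cons.prems(1) list_all2_appendI by metis
  qed
  then have tyL: "typing \<Sigma> [TBase b] (let_list (zip (map TBase bs) Ms') ?N) (TBase (fres \<Sigma> f))"
    by (rule typing_let_list[OF tydMs])
  let ?k = "\<lambda>c vs. eta Y (BaseV (fden I f (map (cden I) cs @ the_base c # map the_base vs)))"
  have step: "rel (TBase (fres \<Sigma> f)) (subst 0 V (let_list (zip (map TBase bs) Ms') ?N))
      (bind_list Fs' Y (?k v))" if V: "vrel (TBase b) V v" for V v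
  proof -
    obtain c where c: "cty \<Sigma> c = b" "V = Const c" "v = BaseV (cden I c)"
      using V by (auto simp: vrel.simps)
    \<comment> \<open>The variable bound first has the largest index \<open>?n\<close> and heads
      \<open>rev [0..<Suc ?n]\<close>. Replacing it appends one constant to \<open>cs\<close> and
      leaves the smaller indices as they are.\<close>
    have "subst ?n V ?N = Func f (map Const (cs @ [c]) @ map Var (rev [0..<?n]))"
      by (auto simp: c(2))
    then have "subst 0 V (let_list (zip (map TBase bs) Ms') ?N) =
        let_list (zip (map TBase bs) Ms')
          (Func f (map Const (cs @ [c]) @ map Var (rev [0..<length Ms'])))"
      using subst_let_list[OF tydMs vrel_tyd[OF V]] len by (simp del: subst.simps)
    then show ?thesis
      using Cons.IH[of "cs @ [c]" Ms' Fs'] rest len c Cons.prems by simp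
  qed
  have "rel (TBase (fres \<Sigma> f)) (LetT (TBase b) M (let_list (zip (map TBase bs) Ms') ?N))
      (bind X Y (\<lambda>v. bind_list Fs' Y (?k v)) F)"
    using rel_let[OF M tyL, of "\<lambda>v. bind_list Fs' Y (?k v)"] step X Cons.prems(5) by simp
  then show ?case using zip_lift_id[OF tydMs] len by simp
qed

definition envrel ::
  "'b ty list \<Rightarrow> ('b, 'c, 'f) tm list \<Rightarrow> ('r, 'd, 'u) val list \<Rightarrow> bool" where
  "envrel \<Gamma> \<theta> \<rho> \<longleftrightarrow> length \<theta> = length \<Gamma> \<and> length \<rho> = length \<Gamma> \<and>
     (\<forall>i<length \<Gamma>. vrel (\<Gamma> ! i) (\<theta> ! i) (\<rho> ! i))"

lemma envrel_Cons: "envrel \<Gamma> \<theta> \<rho> \<Longrightarrow> vrel \<sigma> V v \<Longrightarrow> envrel (\<sigma> # \<Gamma>) (V # \<theta>) (v # \<rho>)"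
  by (auto simp: envrel_def nth_Cons split: nat.split)

lemma envrel_tyd: "envrel \<Gamma> \<theta> \<rho> \<Longrightarrow> list_all2 tyd \<theta> \<Gamma>"
  using vrel_tyd by (auto simp: envrel_def list_all2_conv_all_nth)

lemma envrel_den: "envrel \<Gamma> \<theta> \<rho> \<Longrightarrow> list_all2 (\<lambda>v \<sigma>. v \<in> den \<sigma>) \<rho> \<Gamma>"
  using vrel_den by (auto simp: envrel_def list_all2_conv_all_nth)

lemma envrel_closed: "envrel \<Gamma> \<theta> \<rho> \<Longrightarrow> \<forall>V\<in>set \<theta>. closed_tm V"
  using envrel_tyd typing_closed_tm by (fastforce simp: list_all2_conv_all_nth in_set_conv_nth)

lemma tyd_csubst: "typing \<Sigma> \<Gamma> M \<sigma> \<Longrightarrow> envrel \<Gamma> \<theta> \<rho> \<Longrightarrow> tyd (csubst 0 \<theta> M) \<sigma>"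
  using typing_csubst[of \<Sigma> "[]" \<Gamma>] envrel_tyd by fastforce

text \<open>For a constructor that evaluates its arguments, the evaluation-order axiom gives nested
  lets, and \<open>rel_let\<close> absorbs all effects of the arguments. What remains is the
  constructor at related values.\<close>

lemma fundamental:
  assumes "typing \<Sigma> \<Gamma> M \<sigma>" "occ_types \<Sigma> \<Gamma> M \<subseteq> T" "envrel \<Gamma> \<theta> \<rho>"
  shows "rel \<sigma> (csubst 0 \<theta> M) (sem \<Sigma> I enc \<Gamma> M \<rho>)"
  using assms
proof (induction arbitrary: \<theta> \<rho> rule: typing.induct)
  case (1 i \<Gamma> \<sigma>)
  then show ?case by (auto simp: envrel_def intro!: vrel_rel)
next
  case (2 c b \<Gamma>)
  then have "vrel (TBase b) (Const c) (BaseV (cden I c))" by (simp add: vrel.simps)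
  from vrel_rel[OF this] show ?case using 2(1) by simp
next
  case (3 \<Gamma> Ms f b)
  let ?Ms = "map (csubst 0 \<theta>) Ms"
  let ?Fs = "map (\<lambda>M. (den (tyof \<Sigma> \<Gamma> M), sem \<Sigma> I enc \<Gamma> M \<rho>)) Ms"
  let ?Y = "den (TBase (fres \<Sigma> f))"
  have len: "length Ms = length (fargs \<Sigma> f)" using 3(1) list_all2_lengthD by blast
  have "list_all2 (\<lambda>(M, X, F) b. X = den (TBase b) \<and> rel (TBase b) M F) (zip ?Ms ?Fs) (fargs \<Sigma> f)"
  proof (rule list_all2_all_nthI)
    fix i assume "i < length (zip ?Ms ?Fs)"
    then have i: "i < length Ms" by simp
    have occ: "occ_types \<Sigma> \<Gamma> (Ms ! i) \<subseteq> T" using 3(3) nth_mem[OF i] by auto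
    from list_all2_nthD[OF 3(1) i] have "typing \<Sigma> \<Gamma> (Ms ! i) (TBase (fargs \<Sigma> f ! i))"
      "rel (TBase (fargs \<Sigma> f ! i)) (csubst 0 \<theta> (Ms ! i)) (sem \<Sigma> I enc \<Gamma> (Ms ! i) \<rho>)"
      using occ 3(4) by blast+
    then show "(case zip ?Ms ?Fs ! i of (M, X, F) \<Rightarrow>
        \<lambda>b. X = den (TBase b) \<and> rel (TBase b) M F) (fargs \<Sigma> f ! i)"
      using i by (simp add: tyof_typing)
  qed (simp add: len)
  from rel_let_list[where cs = "[]" and f = f and Y = ?Y, OF _ this] have "rel (TBase b)
      (let_list (zip (map TBase (fargs \<Sigma> f)) ?Ms) (Func f (map Var (rev [0..<length ?Ms]))))
      (sem \<Sigma> I enc \<Gamma> (Func f Ms) \<rho>)"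
    using len 3(2) by (simp add: Let_def)
  moreover have ty: "tyd (csubst 0 \<theta> (Func f Ms)) (TBase b)"
    by (rule tyd_csubst[OF typing.intros(3)]) (use 3 in \<open>auto elim: list_all2_mono\<close>)
  moreover have "eqv (csubst 0 \<theta> (Func f Ms))
      (let_list (zip (map TBase (fargs \<Sigma> f)) ?Ms) (Func f (map Var (rev [0..<length ?Ms])))) (TBase b)"
    using derives.order_Func[of \<Sigma> "[]" f ?Ms "TBase b"] ty by simp
  ultimately show ?case by (blast intro: erel_eqv)
next
  case (4 \<Gamma> L M \<sigma> N)
  let ?B = "TBase (boolT \<Sigma>)"
  let ?L = "csubst 0 \<theta> L" and ?M = "csubst 0 \<theta> M" and ?N = "csubst 0 \<theta> N"
  have ty: "tyd ?L ?B" "tyd ?M \<sigma>" "tyd ?N \<sigma>" using 4 tyd_csubst by blast+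
  then have tyC: "tyd (Cond ?L ?M ?N) \<sigma>" by (intro typing.intros)
  have IH: "rel ?B ?L (sem \<Sigma> I enc \<Gamma> L \<rho>)" "rel \<sigma> ?M (sem \<Sigma> I enc \<Gamma> M \<rho>)"
    "rel \<sigma> ?N (sem \<Sigma> I enc \<Gamma> N \<rho>)"
    using 4 by auto
  let ?f = "\<lambda>v. if v = BaseV (BoolV True) then sem \<Sigma> I enc \<Gamma> M \<rho> else sem \<Sigma> I enc \<Gamma> N \<rho>"
  have "rel \<sigma> (subst 0 V (Cond (Var 0) ?M ?N)) (?f v)" if V: "vrel ?B V v" for V v
  proof -
    obtain c where c: "cty \<Sigma> c = boolT \<Sigma>" "V = Const c" "v = BaseV (cden I c)"
      using V by (auto simp: vrel.simps)
    have tyd: "tyd (Cond (Const c) ?M ?N) \<sigma>" using ty c by (intro typing.intros) auto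
    \<comment> \<open>A related value of base type is a constant, so the provable and the semantic
      choice of branch agree.\<close>
    from bool_const[OF c(1)] show ?thesis
    proof
      assume "c = ttC \<Sigma>"
      then show ?thesis
        using erel_eqv[OF IH(2) derives.cond_tt[OF ty(2,3)]] tyd c tyd_closed[OF ty(2)]
          tyd_closed[OF ty(3)] by (simp add: cden_tt)
    next
      assume "c = ffC \<Sigma>"
      then show ?thesis
        using erel_eqv[OF IH(3) derives.cond_ff[OF ty(2,3)]] tyd c tyd_closed[OF ty(2)]
          tyd_closed[OF ty(3)] by (simp add: cden_ff)
    qed
  qed
  moreover have "typing \<Sigma> [?B] (Cond (Var 0) ?M ?N) \<sigma>"
    by (simp add: typing.intros typing_closed_any[OF ty(2)] typing_closed_any[OF ty(3)])
  ultimately have "rel \<sigma> (LetT ?B ?L (Cond (Var 0) ?M ?N))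
      (bind (den ?B) (den \<sigma>) ?f (sem \<Sigma> I enc \<Gamma> L \<rho>))"
    by (rule rel_let[OF IH(1), rotated])
  from erel_eqv[OF this _ tyC] show ?case
    using derives.order_Cond[OF tyC] tyd_closed[OF ty(2)] tyd_closed[OF ty(3)] 4
    by (simp add: tyof_typing)
next
  case (5 \<Gamma> M \<sigma> N)
  have IH: "rel \<sigma> (csubst 0 \<theta> M) (sem \<Sigma> I enc \<Gamma> M \<rho>)"
    "rel \<sigma> (csubst 0 \<theta> N) (sem \<Sigma> I enc \<Gamma> N \<rho>)"
    using 5 by auto
  then have ty: "tyd (Or (csubst 0 \<theta> M) (csubst 0 \<theta> N)) \<sigma>"
    by (intro typing.intros erel_tyd)
  from erel.choice[OF ty derives.refl[OF ty] IH] show ?case using tyof_typing[OF 5(1)] by simp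
next
  case (6 \<Gamma> N M \<sigma>)
  let ?R = "TBase (rewT \<Sigma>)"
  let ?M = "csubst 0 \<theta> M" and ?N = "csubst 0 \<theta> N"
  have ty: "tyd ?M \<sigma>" "tyd ?N ?R" using 6 tyd_csubst by blast+
  then have tyA: "tyd (Act ?N ?M) \<sigma>" by (intro typing.intros)
  have IH: "rel ?R ?N (sem \<Sigma> I enc \<Gamma> N \<rho>)" "rel \<sigma> ?M (sem \<Sigma> I enc \<Gamma> M \<rho>)"
    using 6 by auto
  let ?f = "\<lambda>v. sel_act (den \<sigma>) (the_rew v) (sem \<Sigma> I enc \<Gamma> M \<rho>)"
  have "rel \<sigma> (subst 0 V (Act (Var 0) ?M)) (?f v)" if V: "vrel ?R V v" for V v
  proof -
    obtain c where c: "cty \<Sigma> c = rewT \<Sigma>" "V = Const c" "v = BaseV (cden I c)"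
      using V by (auto simp: vrel.simps)
    obtain r where r: "cden I c = RewV r" using cden_rew[OF c(1)] by blast
    have "tyd (Act (Const c) ?M) \<sigma>" using ty c by (intro typing.intros) auto
    from erel.reward[OF this derives.refl[OF this] c(1) r IH(2)] show ?thesis
      using c r tyd_closed[OF ty(1)] by simp
  qed
  moreover have "typing \<Sigma> [?R] (Act (Var 0) ?M) \<sigma>"
    by (simp add: typing.intros typing_closed_any[OF ty(1)])
  ultimately have "rel \<sigma> (LetT ?R ?N (Act (Var 0) ?M))
      (bind (den ?R) (den \<sigma>) ?f (sem \<Sigma> I enc \<Gamma> N \<rho>))"
    by (rule rel_let[OF IH(1), rotated])
  from erel_eqv[OF this _ tyA] show ?case
    using derives.order_Act[OF ty(2,1)] tyd_closed[OF ty(1)] 6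
    by (simp add: tyof_typing Let_def)
next
  case (7 \<Gamma>)
  have "vrel TUnit Star StarV" by (simp add: vrel.simps)
  from vrel_rel[OF this] show ?case by simp
next
  case (8 \<Gamma> M \<sigma> N \<tau>)
  let ?M = "csubst 0 \<theta> M" and ?N = "csubst 0 \<theta> N" and ?P = "TProd \<sigma> \<tau>"
  have ty: "tyd ?M \<sigma>" "tyd ?N \<tau>" using 8 tyd_csubst by blast+
  then have tyP: "tyd (Tuple ?M ?N) ?P" by (intro typing.intros)
  have IH: "rel \<sigma> ?M (sem \<Sigma> I enc \<Gamma> M \<rho>)" "rel \<tau> ?N (sem \<Sigma> I enc \<Gamma> N \<rho>)"
    using 8 by auto
  let ?f = "\<lambda>v w. eta (den ?P) (PairV v w)"
  let ?g = "\<lambda>v. bind (den \<tau>) (den ?P) (?f v) (sem \<Sigma> I enc \<Gamma> N \<rho>)"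
  have "rel ?P (subst 0 V (LetT \<tau> ?N (Tuple (Var 1) (Var 0)))) (?g v)" if V: "vrel \<sigma> V v" for V v
  proof -
    have "rel ?P (subst 0 W (Tuple V (Var 0))) (?f v w)" if W: "vrel \<tau> W w" for W w
    proof -
      have "vrel ?P (Tuple V W) (PairV v w)" using V W by (simp add: vrel.simps)
      from vrel_rel[OF this] show ?thesis using tyd_closed[OF vrel_tyd[OF V]] by simp
    qed
    moreover have "typing \<Sigma> [\<tau>] (Tuple V (Var 0)) ?P"
      by (simp add: typing.intros typing_closed_any[OF vrel_tyd[OF V]])
    ultimately have "rel ?P (LetT \<tau> ?N (Tuple V (Var 0))) (?g v)"
      by (rule rel_let[OF IH(2), rotated])
    then show ?thesis using tyd_closed[OF vrel_tyd[OF V]] tyd_closed[OF ty(2)] by simp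
  qed
  moreover have "typing \<Sigma> [\<sigma>] (LetT \<tau> ?N (Tuple (Var 1) (Var 0))) ?P"
    by (rule typing.intros(12)[OF typing.intros(11)[OF typing.intros(8)]])
      (simp_all add: typing.intros typing_closed_any[OF ty(2)])
  ultimately have "rel ?P (LetT \<sigma> ?M (LetT \<tau> ?N (Tuple (Var 1) (Var 0))))
      (bind (den \<sigma>) (den ?P) ?g (sem \<Sigma> I enc \<Gamma> M \<rho>))"
    by (rule rel_let[OF IH(1), rotated])
  from erel_eqv[OF this _ tyP] show ?case
    using derives.order_Tuple[OF ty] tyd_closed[OF ty(2)] 8
    by (simp add: tyof_typing Let_def)
next
  case (9 \<Gamma> M \<sigma> \<tau>)
  let ?M = "csubst 0 \<theta> M" and ?P = "TProd \<sigma> \<tau>"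
  have ty: "tyd ?M ?P" using 9 tyd_csubst by blast
  then have tyF: "tyd (Fst ?M) \<sigma>" by (rule typing.intros)
  have IH: "rel ?P ?M (sem \<Sigma> I enc \<Gamma> M \<rho>)" using 9 by auto
  let ?f = "\<lambda>v. eta (den \<sigma>) (vfst v)"
  have "rel \<sigma> (subst 0 V (Fst (Var 0))) (?f v)" if V: "vrel ?P V v" for V v
  proof -
    obtain V1 V2 x y where v: "V = Tuple V1 V2" "v = PairV x y" "vrel \<sigma> V1 x" "vrel \<tau> V2 y"
      using V by (auto simp: vrel.simps)
    show ?thesis
      using erel_eqv[OF vrel_rel[OF v(3)] fst_Tuple_pure[OF vrel_pure[OF v(3)] vrel_pure[OF v(4)]]]
        typing.intros(9)[OF vrel_tyd[OF V]] vrel_tyd[OF v(3)] v by simp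
  qed
  moreover have "typing \<Sigma> [?P] (Fst (Var 0)) \<sigma>"
    by (rule typing.intros(9)[where \<tau> = \<tau>]) (simp add: typing.intros)
  ultimately have "rel \<sigma> (LetT ?P ?M (Fst (Var 0)))
      (bind (den ?P) (den \<sigma>) ?f (sem \<Sigma> I enc \<Gamma> M \<rho>))"
    by (rule rel_let[OF IH, rotated])
  from erel_eqv[OF this _ tyF] show ?case
    using derives.order_Fst[OF ty] 9 by (simp add: tyof_typing[OF 9(1)] Let_def)
next
  case (10 \<Gamma> M \<sigma> \<tau>)
  let ?M = "csubst 0 \<theta> M" and ?P = "TProd \<sigma> \<tau>"
  have ty: "tyd ?M ?P" using 10 tyd_csubst by blast
  then have tyF: "tyd (Snd ?M) \<tau>" by (rule typing.intros)
  have IH: "rel ?P ?M (sem \<Sigma> I enc \<Gamma> M \<rho>)" using 10 by auto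
  let ?f = "\<lambda>v. eta (den \<tau>) (vsnd v)"
  have "rel \<tau> (subst 0 V (Snd (Var 0))) (?f v)" if V: "vrel ?P V v" for V v
  proof -
    obtain V1 V2 x y where v: "V = Tuple V1 V2" "v = PairV x y" "vrel \<sigma> V1 x" "vrel \<tau> V2 y"
      using V by (auto simp: vrel.simps)
    show ?thesis
      using erel_eqv[OF vrel_rel[OF v(4)] snd_Tuple_pure[OF vrel_pure[OF v(3)] vrel_pure[OF v(4)]]]
        typing.intros(10)[OF vrel_tyd[OF V]] vrel_tyd[OF v(3)] v by simp
  qed
  moreover have "typing \<Sigma> [?P] (Snd (Var 0)) \<tau>"
    by (rule typing.intros(10)[where \<sigma> = \<sigma>]) (simp add: typing.intros)
  ultimately have "rel \<tau> (LetT ?P ?M (Snd (Var 0)))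
      (bind (den ?P) (den \<tau>) ?f (sem \<Sigma> I enc \<Gamma> M \<rho>))"
    by (rule rel_let[OF IH, rotated])
  from erel_eqv[OF this _ tyF] show ?case
    using derives.order_Snd[OF ty] 10 by (simp add: tyof_typing[OF 10(1)] Let_def)
next
  case (11 \<sigma> \<Gamma> M \<tau>)
  let ?N = "csubst 1 \<theta> M" and ?F = "TFun \<sigma> \<tau>"
  let ?g = "\<lambda>a\<in>den \<sigma>. sem \<Sigma> I enc (\<sigma> # \<Gamma>) M (a # \<rho>)"
  have ty: "tyd (Lam \<sigma> ?N) ?F"
    using tyd_csubst[OF typing.intros(11)[OF 11(1)] 11(4)] by simp
  have tyN: "typing \<Sigma> [\<sigma>] ?N \<tau>" using ty by (auto elim: typing_LamE)
  have FT: "?F \<in> T" using occ_types_typing[OF typing.intros(11)[OF 11(1)]] 11(3) by blast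
  have occ: "occ_types \<Sigma> (\<sigma> # \<Gamma>) M \<subseteq> T" using 11(3) by simp
  have g: "?g \<in> den \<sigma> \<rightarrow>\<^sub>E Sel (den \<tau>)"
    using sem_Sel[OF 11(1) occ] envrel_den[OF 11(4)] by auto
  have "rel \<tau> (App (Lam \<sigma> ?N) V) (the_fun I enc \<sigma> \<tau> (FunV (enc ?g)) v)"
    if V: "vrel \<sigma> V v" for V v
  proof -
    have "subst 0 V ?N = csubst 0 (V # \<theta>) M"
      using subst_csubst[OF typing_closed_tm[OF vrel_tyd[OF V]] envrel_closed[OF 11(4)], of 0] by simp
    then have "eqv (App (Lam \<sigma> ?N) V) (csubst 0 (V # \<theta>) M) \<tau>"
      using beta_pure[OF tyN vrel_pure[OF V]] by simp
    \<comment> \<open>The induction hypothesis in the extended environment concerns the reduct;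
      \<open>erel_eqv\<close> carries it back along beta to the application.\<close>
    from erel_eqv[OF 11(2)[OF occ envrel_Cons[OF 11(4) V]] this
        typing.intros(12)[OF ty vrel_tyd[OF V]]]
    show ?thesis using the_fun_FunV[OF FT g] vrel_den[OF V] by simp
  qed
  with ty g have "vrel ?F (Lam \<sigma> ?N) (FunV (enc ?g))" by (simp add: vrel.simps(4) del: the_fun.simps)
  from vrel_rel[OF this] show ?case using tyof_typing[OF 11(1)] by simp
next
  case (12 \<Gamma> M \<sigma> \<tau> N)
  let ?M = "csubst 0 \<theta> M" and ?N = "csubst 0 \<theta> N" and ?F = "TFun \<sigma> \<tau>"
  have ty: "tyd ?M ?F" "tyd ?N \<sigma>" using 12 tyd_csubst by blast+
  then have tyA: "tyd (App ?M ?N) \<tau>" by (rule typing.intros)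
  have IH: "rel ?F ?M (sem \<Sigma> I enc \<Gamma> M \<rho>)" "rel \<sigma> ?N (sem \<Sigma> I enc \<Gamma> N \<rho>)"
    using 12 by auto
  let ?f = "\<lambda>g a. the_fun I enc \<sigma> \<tau> g a"
  let ?g = "\<lambda>g. bind (den \<sigma>) (den \<tau>) (?f g) (sem \<Sigma> I enc \<Gamma> N \<rho>)"
  have "rel \<tau> (subst 0 V (LetT \<sigma> ?N (App (Var 1) (Var 0)))) (?g v)" if V: "vrel ?F V v" for V v
  proof -
    have "rel \<tau> (subst 0 W (App V (Var 0))) (?f v w)" if W: "vrel \<sigma> W w" for W w
      using V W tyd_closed[OF vrel_tyd[OF V]] by (simp add: vrel.simps(4))
    moreover have "typing \<Sigma> [\<sigma>] (App V (Var 0)) \<tau>"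
      by (rule typing.intros(12)[OF typing_closed_any[OF vrel_tyd[OF V]]]) (simp add: typing.intros)
    ultimately have "rel \<tau> (LetT \<sigma> ?N (App V (Var 0))) (?g v)"
      by (rule rel_let[OF IH(2), rotated])
    then show ?thesis using tyd_closed[OF vrel_tyd[OF V]] tyd_closed[OF ty(2)] by simp
  qed
  moreover have "typing \<Sigma> [?F] (LetT \<sigma> ?N (App (Var 1) (Var 0))) \<tau>"
    by (rule typing.intros(12)[OF typing.intros(11)[OF typing.intros(12)[of _ _ _ \<sigma>]]])
      (simp_all add: typing.intros typing_closed_any[OF ty(2)])
  ultimately have "rel \<tau> (LetT ?F ?M (LetT \<sigma> ?N (App (Var 1) (Var 0))))
      (bind (den ?F) (den \<tau>) ?g (sem \<Sigma> I enc \<Gamma> M \<rho>))"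
    by (rule rel_let[OF IH(1), rotated])
  from erel_eqv[OF this _ tyA] show ?case
    using derives.order_App[OF ty] tyd_closed[OF ty(2)]
    by (simp add: tyof_typing[OF 12(1)] tyof_typing[OF 12(2)] Let_def)
qed

subsection \<open>Canonical forms\<close>

lemma add_le_iff: "r + t \<le> s + t \<longleftrightarrow> r \<le> (s::'r)"
  using interp_ok unfolding interp_ok_def by blast

lemma add_le_iff': "t + r \<le> t + s \<longleftrightarrow> r \<le> (s::'r)"
  using add_le_iff by (simp only: add.commute[of t])

definition rew :: "'c \<Rightarrow> 'r" where
  "rew c = (case cden I c of RewV r \<Rightarrow> r)"

lemma cden_RewV: "cty \<Sigma> c = rewT \<Sigma> \<Longrightarrow> cden I c = RewV (rew c)"
  using cden_rew[of c] by (auto simp: rew_def)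

lemma rew_zero: "rew (zeroC \<Sigma>) = 0"
  by (simp add: rew_def cden_zero)

definition atom :: "'b \<Rightarrow> 'c \<times> 'c \<Rightarrow> (('r, 'd, 'u) val, 'r) sel" where
  "atom b p = sel_act (den (TBase b)) (rew (fst p)) (eta (den (TBase b)) (BaseV (cden I (snd p))))"

fun tree_sem :: "'b \<Rightarrow> ('c \<times> 'c) list \<Rightarrow> (('r, 'd, 'u) val, 'r) sel" where
  "tree_sem b [] = undefined"
| "tree_sem b [p] = atom b p"
| "tree_sem b (p # q # L) = sel_or (den (TBase b)) (atom b p) (tree_sem b (q # L))"

definition entries :: "'b \<Rightarrow> ('c \<times> 'c) list \<Rightarrow> bool" where
  "entries b L \<longleftrightarrow> (\<forall>(c, v)\<in>set L. cty \<Sigma> c = rewT \<Sigma> \<and> cty \<Sigma> v = b)"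

lemma entries_simps [simp]:
  "entries b []"
  "entries b (p # L) \<longleftrightarrow> cty \<Sigma> (fst p) = rewT \<Sigma> \<and> cty \<Sigma> (snd p) = b \<and> entries b L"
  "entries b (L @ L') \<longleftrightarrow> entries b L \<and> entries b L'"
  by (auto simp: entries_def)

section \<open>Algebra of choices in the selection monad\<close>

lemma Rw_sel_or:
  fixes F G :: "('x, 'r) sel"
  assumes "\<gamma> \<in> X \<rightarrow>\<^sub>E UNIV"
  shows "Rw (sel_or X F G) \<gamma> = max (Rw F \<gamma>) (Rw G \<gamma>)"
  using assms by (auto simp: sel_or_apply Rw_eq max_def)

text \<open>The reward of a choice is a maximum and ties go to the left, so both bracketings return
  the leftmost of the best alternatives.\<close>

lemma sel_or_assoc:
  fixes F G H :: "('x, 'r) sel"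
  shows "sel_or X (sel_or X F G) H = sel_or X F (sel_or X G H)"
proof (rule extensionalityI[of _ "X \<rightarrow>\<^sub>E UNIV"])
  fix \<gamma> assume "\<gamma> \<in> X \<rightarrow>\<^sub>E (UNIV :: 'r set)"
  then show "sel_or X (sel_or X F G) H \<gamma> = sel_or X F (sel_or X G H) \<gamma>"
    by (simp add: sel_or_apply Rw_sel_or le_max_iff_disj) (auto dest: order_trans)
qed (simp_all add: sel_or_def)

text \<open>Adding \<open>r\<close> preserves and reflects the order, so the comparison comes out
  the same, ties included.\<close>

lemma sel_act_or:
  fixes F G :: "('x, 'r) sel"
  shows "sel_act X r (sel_or X F G) = sel_or X (sel_act X r F) (sel_act X r G)"
proof (rule extensionalityI[of _ "X \<rightarrow>\<^sub>E UNIV"])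
  fix \<gamma> assume "\<gamma> \<in> X \<rightarrow>\<^sub>E (UNIV :: 'r set)"
  then show "sel_act X r (sel_or X F G) \<gamma> = sel_or X (sel_act X r F) (sel_act X r G) \<gamma>"
    by (auto simp: sel_or_apply sel_act_apply Rw_eq add.assoc add_le_iff')
qed (simp_all add: sel_or_def sel_act_def)

lemma atom_apply:
  "\<gamma> \<in> den (TBase b) \<rightarrow>\<^sub>E UNIV \<Longrightarrow> atom b p \<gamma> = (rew (fst p), BaseV (cden I (snd p)))"
  by (simp add: atom_def sel_act_apply eta_apply)

lemma atom_extensional: "atom b p \<in> extensional (den (TBase b) \<rightarrow>\<^sub>E UNIV)"
  by (simp add: atom_def sel_act_def)

lemma tree_sem_append:
  "L \<noteq> [] \<Longrightarrow> L' \<noteq> [] \<Longrightarrow>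
    tree_sem b (L @ L') = sel_or (den (TBase b)) (tree_sem b L) (tree_sem b L')"
proof (induction b L rule: tree_sem.induct)
  case (2 b p)
  then show ?case by (cases L') simp_all
qed (simp_all add: sel_or_assoc)

text \<open>Any continuation adds the same amount to two entries with the same value, and
  cancellation leaves a comparison of their rewards that no longer depends on it.\<close>

lemma atom_or_atom:
  assumes "snd p = snd q"
  shows "sel_or (den (TBase b)) (atom b p) (atom b q) =
    (if rew (fst q) \<le> rew (fst p) then atom b p else atom b q)"
proof (rule extensionalityI[of _ "den (TBase b) \<rightarrow>\<^sub>E UNIV"])
  fix \<gamma> assume "\<gamma> \<in> den (TBase b) \<rightarrow>\<^sub>E (UNIV :: 'r set)"
  then show "sel_or (den (TBase b)) (atom b p) (atom b q) \<gamma> =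
      (if rew (fst q) \<le> rew (fst p) then atom b p else atom b q) \<gamma>"
    using assms by (simp add: sel_or_apply Rw_eq atom_apply add_le_iff del: tden.simps)
qed (simp_all add: sel_or_def atom_extensional del: tden.simps)

text \<open>\<open>G\<close> may win against both, but one of the two entries is never returned: the
  later one if its reward is not larger, otherwise the earlier one.\<close>

lemma atom_or_or_atom:
  assumes "snd p = snd q"
  shows "sel_or (den (TBase b)) (atom b p) (sel_or (den (TBase b)) G (atom b q)) =
    (if rew (fst q) \<le> rew (fst p) then sel_or (den (TBase b)) (atom b p) G
     else sel_or (den (TBase b)) G (atom b q))"
proof (rule extensionalityI[of _ "den (TBase b) \<rightarrow>\<^sub>E UNIV"])
  fix \<gamma> assume \<gamma>: "\<gamma> \<in> den (TBase b) \<rightarrow>\<^sub>E (UNIV :: 'r set)"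
  have "Rw (atom b q) \<gamma> \<le> Rw (atom b p) \<gamma> \<longleftrightarrow> rew (fst q) \<le> rew (fst p)"
    using assms \<gamma> by (simp add: Rw_eq atom_apply add_le_iff del: tden.simps)
  then show "sel_or (den (TBase b)) (atom b p) (sel_or (den (TBase b)) G (atom b q)) \<gamma> =
    (if rew (fst q) \<le> rew (fst p) then sel_or (den (TBase b)) (atom b p) G
     else sel_or (den (TBase b)) G (atom b q)) \<gamma>"
    using \<gamma> by (auto simp: sel_or_apply Rw_eq simp del: tden.simps)
qed (simp_all add: sel_or_def del: tden.simps)

lemma tree_sem_max:
  assumes "\<gamma> \<in> den (TBase b) \<rightarrow>\<^sub>E UNIV" "L \<noteq> []"
  shows "(\<exists>p\<in>set L. tree_sem b L \<gamma> = atom b p \<gamma>) \<and>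
    (\<forall>p\<in>set L. Rw (atom b p) \<gamma> \<le> Rw (tree_sem b L) \<gamma>)"
  using assms
proof (induction b L rule: tree_sem.induct)
  case (3 b p q L)
  then show ?case by (auto simp: sel_or_apply Rw_eq simp del: tden.simps)
qed simp_all

text \<open>The source is the reward constant not denoting 0, compared with 0. If \<open>R\<close>
  were trivial, no continuation could prefer one entry to another.\<close>

lemma ex_less: "\<exists>d e. (e::'r) < d"
proof -
  have "\<exists>c. cty \<Sigma> c = rewT \<Sigma> \<and> cden I c \<noteq> RewV 0"
    using interp_ok unfolding interp_ok_def by (elim conjE)
  then obtain c where "rew c \<noteq> 0" using cden_RewV by auto
  then have "rew c < 0 \<or> 0 < rew c" by (simp add: neq_iff)
  then show ?thesis by blast
qed

text \<open>The continuation balances the rewards: the value of each entry is credited with the rewards of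
  all other entries, and then that of the entry to be chosen with something more than the rest.\<close>

lemma tree_sem_selects:
  assumes "entries b L" "distinct (map snd L)" "p \<in> set L"
  shows "\<exists>\<gamma>\<in>den (TBase b) \<rightarrow>\<^sub>E UNIV. tree_sem b L \<gamma> = (rew (fst p), BaseV (cden I (snd p)))"
proof -
  obtain d e :: 'r where de: "e < d" using ex_less by blast
  let ?v = "\<lambda>q. BaseV (cden I (snd q)) :: ('r, 'd, 'u) val"
  define \<gamma> where "\<gamma> = (\<lambda>x\<in>den (TBase b).
    (\<Sum>q | q \<in> set L \<and> ?v q \<noteq> x. rew (fst q)) + (if x = ?v p then d else e))"
  have \<gamma>: "\<gamma> \<in> den (TBase b) \<rightarrow>\<^sub>E UNIV" unfolding \<gamma>_def by simp
  \<comment> \<open>Distinct value constants have distinct denotations, so the element identifies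
    the entry and the sum in \<open>\<gamma>\<close> leaves out exactly that one.\<close>
  have inj: "q = q'" if "q \<in> set L" "q' \<in> set L" "?v q = ?v q'" for q q'
  proof -
    have "snd q = snd q'"
      using that assms(1) cden_inj[of "snd q" "snd q'"] by (auto simp: entries_def split_beta)
    then show ?thesis
      using that assms(2) by (auto simp: distinct_map inj_on_def)
  qed
  let ?P = "\<Sum>q\<in>set L. rew (fst q)"
  have Rw_q: "Rw (atom b q) \<gamma> = ?P + (if q = p then d else e)" if q: "q \<in> set L" for q
  proof -
    have "?v q \<in> den (TBase b)"
      using q assms(1) cden_bden[of "snd q"] by (auto simp: entries_def)
    then have "\<gamma> (?v q) = (\<Sum>q' | q' \<in> set L \<and> ?v q' \<noteq> ?v q. rew (fst q')) +
        (if ?v q = ?v p then d else e)"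
      unfolding \<gamma>_def by simp
    also have "{q'. q' \<in> set L \<and> ?v q' \<noteq> ?v q} = set L - {q}" using q inj by blast
    also have "?v q = ?v p \<longleftrightarrow> q = p" using q assms(3) inj by blast
    finally show ?thesis
      using \<gamma> q by (simp add: Rw_eq atom_apply sum.remove[of "set L" q] add.assoc del: tden.simps)
  qed
  have "L \<noteq> []" using assms(3) by auto
  from tree_sem_max[OF \<gamma> this] obtain q where q: "q \<in> set L" "tree_sem b L \<gamma> = atom b q \<gamma>"
    and max: "\<forall>p\<in>set L. Rw (atom b p) \<gamma> \<le> Rw (tree_sem b L) \<gamma>" by blast
  have "Rw (atom b p) \<gamma> \<le> Rw (atom b q) \<gamma>" using max assms(3) q(2) by (simp add: Rw_eq)
  then have "d \<le> (if q = p then d else e)"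
    by (simp add: Rw_q q(1) assms(3) add_le_iff')
  then have "q = p" using de by (auto split: if_splits)
  then show ?thesis using \<gamma> q atom_apply[OF \<gamma>] by auto
qed

subsection \<open>Equations between canonical forms\<close>

lemma pure_Const_tyd: "cty \<Sigma> c = b \<Longrightarrow> pure_tm (Const c) (TBase b)"
  by (intro derives.pure_Const typing.intros)

lemma typing_entry:
  "cty \<Sigma> (fst p) = rewT \<Sigma> \<Longrightarrow> cty \<Sigma> (snd p) = b \<Longrightarrow>
    typing \<Sigma> \<Gamma> (Act (Const (fst p)) (Const (snd p))) (TBase b)"
  by (intro typing.intros)

lemma tree_tm_tyd: "L \<noteq> [] \<Longrightarrow> entries b L \<Longrightarrow> tyd (tree_tm L) (TBase b)"
  by (induction L rule: tree_tm.induct) (simp_all add: typing_entry typing.intros)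

text \<open>The axioms are stated for reward variables; these are their instances for reward constants.\<close>

lemma subst_rew_consts:
  assumes "derives \<Sigma> (selection_axioms \<Sigma>) [TBase (rewT \<Sigma>), TBase (rewT \<Sigma>)] A"
    and "cty \<Sigma> c = rewT \<Sigma>" "cty \<Sigma> c' = rewT \<Sigma>"
  shows "derives \<Sigma> (selection_axioms \<Sigma>) [] (subst_assertion 0 (Const c') (subst_assertion 0 (Const c) A))"
  using subst_const_twice[OF assms(1) pure_Const_tyd pure_Const_tyd] assms(2,3)
  by (simp add: typing.intros)

lemma or_assoc_eqv:
  "tyd L \<sigma> \<Longrightarrow> tyd M \<sigma> \<Longrightarrow> tyd N \<sigma> \<Longrightarrow> eqv (Or (Or L M) N) (Or L (Or M N)) \<sigma>"
  by (intro derives.axiom selection_axioms.or_assoc)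

lemma act_or_eqv:
  assumes "cty \<Sigma> c = rewT \<Sigma>" "tyd M \<sigma>" "tyd N \<sigma>"
  shows "eqv (Act (Const c) (Or M N)) (Or (Act (Const c) M) (Act (Const c) N)) \<sigma>"
proof -
  have "derives \<Sigma> (selection_axioms \<Sigma>) [TBase (rewT \<Sigma>), TBase (rewT \<Sigma>)]
      (Eqn (Act (Var 0) (Or M N)) (Or (Act (Var 0) M) (Act (Var 0) N)) \<sigma>)"
    by (intro derives.axiom selection_axioms.act_or)
      (simp_all add: typing.intros assms(2,3)[THEN typing_closed_any])
  \<comment> \<open>The second reward variable is a dummy that brings the axiom into the form of
    \<open>subst_rew_consts\<close>; \<open>c\<close> is substituted for it too.\<close>
  from subst_rew_consts[OF this assms(1,1)] show ?thesis
    using tyd_closed[OF assms(2)] tyd_closed[OF assms(3)] by simp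
qed

lemma plus_sig: "fargs \<Sigma> (plusF \<Sigma>) = [rewT \<Sigma>, rewT \<Sigma>]" "fres \<Sigma> (plusF \<Sigma>) = rewT \<Sigma>"
  and leq_sig: "fargs \<Sigma> (leqF \<Sigma>) = [rewT \<Sigma>, rewT \<Sigma>]" "fres \<Sigma> (leqF \<Sigma>) = boolT \<Sigma>"
  using signature_ok unfolding signature_ok_def by blast+

definition cplus :: "'c \<Rightarrow> 'c \<Rightarrow> 'c" where
  "cplus c c' = fval \<Sigma> (plusF \<Sigma>) [c, c']"

lemma cplus:
  assumes "cty \<Sigma> c = rewT \<Sigma>" "cty \<Sigma> c' = rewT \<Sigma>"
  shows "cty \<Sigma> (cplus c c') = rewT \<Sigma>" "rew (cplus c c') = rew c + rew c'"
proof -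
  have args: "map (cty \<Sigma>) [c, c'] = fargs \<Sigma> (plusF \<Sigma>)" using assms plus_sig by simp
  show "cty \<Sigma> (cplus c c') = rewT \<Sigma>" using cty_fval[OF args] plus_sig by (simp add: cplus_def)
  have "fden I (plusF \<Sigma>) [RewV (rew c), RewV (rew c')] = RewV (rew c + rew c')"
    using interp_ok unfolding interp_ok_def by blast
  then have "cden I (cplus c c') = RewV (rew c + rew c')"
    using fden_cden[OF args] cden_RewV[OF assms(1)] cden_RewV[OF assms(2)] by (simp add: cplus_def)
  then show "rew (cplus c c') = rew c + rew c'" unfolding rew_def by simp
qed

lemma act_act_eqv:
  assumes c: "cty \<Sigma> c = rewT \<Sigma>" "cty \<Sigma> c' = rewT \<Sigma>" and M: "tyd M \<sigma>"
  shows "eqv (Act (Const c) (Act (Const c') M)) (Act (Const (cplus c c')) M) \<sigma>"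
proof -
  have "derives \<Sigma> (selection_axioms \<Sigma>) [TBase (rewT \<Sigma>), TBase (rewT \<Sigma>)]
      (Eqn (Act (Var 0) (Act (Var 1) M)) (Act (Func (plusF \<Sigma>) [Var 0, Var 1]) M) \<sigma>)"
    by (intro derives.axiom selection_axioms.act_act)
      (simp_all add: typing.intros M[THEN typing_closed_any])
  from subst_rew_consts[OF this c]
  have 1: "eqv (Act (Const c) (Act (Const c') M)) (Act (Func (plusF \<Sigma>) [Const c, Const c']) M) \<sigma>"
    using tyd_closed[OF M] by simp
  have "eqv (Func (plusF \<Sigma>) [Const c, Const c']) (Const (cplus c c')) (TBase (rewT \<Sigma>))"
    using derives.func_val[of \<Sigma> "[c, c']" "plusF \<Sigma>"] c plus_sig by (simp add: cplus_def)
  from derives.trans[OF 1 derives.cong_Act[OF this derives.refl[OF M]]] show ?thesis .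
qed

text \<open>The comparison of two constants evaluates to the constant denoting its truth value,
  which injectivity identifies as \<open>ttC\<close> or \<open>ffC\<close>. In this way the order of
  \<open>R\<close> decides a provable equation.\<close>

lemma ge_eqv:
  assumes c: "cty \<Sigma> c = rewT \<Sigma>" "cty \<Sigma> c' = rewT \<Sigma>" and M: "tyd M \<sigma>" and N: "tyd N \<sigma>"
  shows "eqv (Cond (geT \<Sigma> (Const c) (Const c')) M N) (if rew c' \<le> rew c then M else N) \<sigma>"
proof -
  let ?d = "fval \<Sigma> (leqF \<Sigma>) [c', c]"
  have args: "map (cty \<Sigma>) [c', c] = fargs \<Sigma> (leqF \<Sigma>)" using c leq_sig by simp
  have "fden I (leqF \<Sigma>) [RewV (rew c'), RewV (rew c)] = BoolV (rew c' \<le> rew c)"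
    using interp_ok unfolding interp_ok_def by blast
  then have d: "cden I ?d = BoolV (rew c' \<le> rew c)"
    using fden_cden[OF args] cden_RewV[OF c(1)] cden_RewV[OF c(2)] by simp
  have ctyd: "cty \<Sigma> ?d = boolT \<Sigma>" using cty_fval[OF args] leq_sig by simp
  have "eqv (geT \<Sigma> (Const c) (Const c')) (Const ?d) (TBase (boolT \<Sigma>))"
    using derives.func_val[OF args] leq_sig by simp
  from derives.cong_Cond[OF this derives.refl[OF M] derives.refl[OF N]]
  have 1: "eqv (Cond (geT \<Sigma> (Const c) (Const c')) M N) (Cond (Const ?d) M N) \<sigma>" .
  show ?thesis
  proof (cases "rew c' \<le> rew c")
    case True
    then have "?d = ttC \<Sigma>" using cden_inj ctyd d by (metis cden_tt cty_tt)
    then show ?thesis using True 1 derives.trans derives.cond_tt[OF M N] by fastforce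
  next
    case False
    then have "?d = ffC \<Sigma>" using cden_inj ctyd d by (metis cden_ff cty_ff)
    then show ?thesis using False 1 derives.trans derives.cond_ff[OF M N] by fastforce
  qed
qed

lemma or_eqv:
  assumes c: "cty \<Sigma> c = rewT \<Sigma>" "cty \<Sigma> c' = rewT \<Sigma>" and M: "tyd M \<sigma>"
  shows "eqv (Or (Act (Const c) M) (Act (Const c') M))
    (if rew c' \<le> rew c then Act (Const c) M else Act (Const c') M) \<sigma>"
proof -
  have "derives \<Sigma> (selection_axioms \<Sigma>) [TBase (rewT \<Sigma>), TBase (rewT \<Sigma>)]
      (Eqn (Cond (geT \<Sigma> (Var 0) (Var 1)) (Act (Var 0) M) (Act (Var 1) M))
        (Or (Act (Var 0) M) (Act (Var 1) M)) \<sigma>)"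
    by (intro derives.axiom selection_axioms.cond_or)
      (simp_all add: typing.intros M[THEN typing_closed_any])
  from subst_rew_consts[OF this c]
  have "eqv (Cond (geT \<Sigma> (Const c) (Const c')) (Act (Const c) M) (Act (Const c') M))
      (Or (Act (Const c) M) (Act (Const c') M)) \<sigma>"
    using tyd_closed[OF M] by simp
  from derives.trans[OF derives.sym[OF this] ge_eqv[OF c]]
  show ?thesis using M c by (simp add: typing.intros)
qed

text \<open>This is \<open>cond_or_or\<close> with its left-nested choice reassociated to the right,
  the nesting of \<open>tree_tm\<close>.\<close>

lemma or_or_eqv:
  assumes c: "cty \<Sigma> c = rewT \<Sigma>" "cty \<Sigma> c' = rewT \<Sigma>" and M: "tyd M \<sigma>" and N: "tyd N \<sigma>"
  shows "eqv (Or (Act (Const c) M) (Or N (Act (Const c') M)))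
    (if rew c' \<le> rew c then Or (Act (Const c) M) N else Or N (Act (Const c') M)) \<sigma>"
proof -
  have tys: "tyd (Act (Const c) M) \<sigma>" "tyd (Act (Const c') M) \<sigma>"
    using c M by (simp_all add: typing.intros)
  have "derives \<Sigma> (selection_axioms \<Sigma>) [TBase (rewT \<Sigma>), TBase (rewT \<Sigma>)]
      (Eqn (Cond (geT \<Sigma> (Var 0) (Var 1)) (Or (Act (Var 0) M) N) (Or N (Act (Var 1) M)))
        (Or (Or (Act (Var 0) M) N) (Act (Var 1) M)) \<sigma>)"
    by (intro derives.axiom selection_axioms.cond_or_or)
      (simp_all add: typing.intros M[THEN typing_closed_any] N[THEN typing_closed_any])
  from subst_rew_consts[OF this c]
  have "eqv (Cond (geT \<Sigma> (Const c) (Const c')) (Or (Act (Const c) M) N) (Or N (Act (Const c') M)))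
      (Or (Or (Act (Const c) M) N) (Act (Const c') M)) \<sigma>"
    using tyd_closed[OF M] tyd_closed[OF N] by simp
  from derives.trans[OF derives.trans[OF derives.sym[OF or_assoc_eqv[OF tys(1) N tys(2)]]
      derives.sym[OF this]] ge_eqv[OF c]]
  show ?thesis using N tys by (simp add: typing.intros)
qed

lemma tree_tm_append:
  "L \<noteq> [] \<Longrightarrow> L' \<noteq> [] \<Longrightarrow> entries b L \<Longrightarrow> entries b L' \<Longrightarrow>
    eqv (tree_tm (L @ L')) (Or (tree_tm L) (tree_tm L')) (TBase b)"
proof (induction L rule: tree_tm.induct)
  case (2 p)
  then obtain q Q where [simp]: "L' = q # Q" by (cases L') auto
  show ?case using 2 derives.refl[OF tree_tm_tyd[of "p # q # Q" b]] by simp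
next
  case (3 p q L)
  let ?A = "Act (Const (fst p)) (Const (snd p))"
  have A: "tyd ?A (TBase b)" and L: "tyd (tree_tm (q # L)) (TBase b)" "tyd (tree_tm L') (TBase b)"
    using 3 typing_entry tree_tm_tyd[of "q # L" b] tree_tm_tyd[of L' b] by auto
  have "eqv (tree_tm ((q # L) @ L')) (Or (tree_tm (q # L)) (tree_tm L')) (TBase b)"
    using 3 by simp
  from derives.trans[OF derives.cong_Or[OF derives.refl[OF A] this]
      derives.sym[OF or_assoc_eqv[OF A L]]]
  show ?case by simp
qed simp

section \<open>Removing repeated values\<close>

definition same :: "'b \<Rightarrow> ('c \<times> 'c) list \<Rightarrow> ('c \<times> 'c) list \<Rightarrow> bool" where
  "same b L L' \<longleftrightarrow> L \<noteq> [] \<and> L' \<noteq> [] \<and> entries b L \<and> entries b L' \<and>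
     eqv (tree_tm L) (tree_tm L') (TBase b) \<and> tree_sem b L = tree_sem b L'"

lemma same_append_right:
  assumes "same b K K'" "entries b C"
  shows "same b (K @ C) (K' @ C)"
proof (cases "C = []")
  case False
  have K: "K \<noteq> []" "K' \<noteq> []" "entries b K" "entries b K'" "eqv (tree_tm K) (tree_tm K') (TBase b)"
    using assms(1) by (auto simp: same_def)
  have "eqv (Or (tree_tm K) (tree_tm C)) (Or (tree_tm K') (tree_tm C)) (TBase b)"
    by (intro derives.cong_Or derives.refl tree_tm_tyd K assms False)
  from derives.trans[OF derives.trans[OF tree_tm_append this] derives.sym[OF tree_tm_append]]
  show ?thesis
    using assms False K by (simp add: same_def tree_sem_append)
qed (use assms in simp)

lemma same_append_left:
  assumes "same b K K'" "entries b C"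
  shows "same b (C @ K) (C @ K')"
proof (cases "C = []")
  case False
  have K: "K \<noteq> []" "K' \<noteq> []" "entries b K" "entries b K'" "eqv (tree_tm K) (tree_tm K') (TBase b)"
    using assms(1) by (auto simp: same_def)
  have "eqv (Or (tree_tm C) (tree_tm K)) (Or (tree_tm C) (tree_tm K')) (TBase b)"
    by (intro derives.cong_Or derives.refl tree_tm_tyd K assms False)
  from derives.trans[OF derives.trans[OF tree_tm_append this] derives.sym[OF tree_tm_append]]
  show ?thesis
    using assms False K by (simp add: same_def tree_sem_append)
qed (use assms in simp)

text \<open>The block \<open>B\<close> between the two entries plays the part of \<open>N\<close> in
  \<open>cond_or_or\<close>. Since there is no empty choice, adjacent entries need
  \<open>cond_or\<close> instead. On a tie the later entry goes, as choice favours the left.\<close>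

lemma same_prune:
  assumes ent: "entries b (p # B @ [q])" and pq: "snd p = snd q"
  shows "same b (p # B @ [q]) (if rew (fst q) \<le> rew (fst p) then p # B else B @ [q])"
proof -
  have c: "cty \<Sigma> (fst p) = rewT \<Sigma>" "cty \<Sigma> (fst q) = rewT \<Sigma>"
    and v: "tyd (Const (snd q)) (TBase b)" using ent by (auto intro: typing.intros)
  show ?thesis
  proof (cases "B = []")
    case True
    then show ?thesis
      using ent or_eqv[OF c v] pq atom_or_atom[OF pq, of b]
      by (cases "rew (fst q) \<le> rew (fst p)") (simp_all add: same_def del: tden.simps)
  next
    case False
    have B: "tyd (tree_tm B) (TBase b)" using tree_tm_tyd[OF False] ent by simp
    have sem1: "tree_sem b (p # B) = sel_or (den (TBase b)) (atom b p) (tree_sem b B)"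
      and sem2: "tree_sem b (B @ [q]) = sel_or (den (TBase b)) (tree_sem b B) (atom b q)"
      and sem3: "tree_sem b (p # B @ [q]) =
        sel_or (den (TBase b)) (atom b p) (sel_or (den (TBase b)) (tree_sem b B) (atom b q))"
      using False tree_sem_append[of B "[q]" b] by (cases B; simp)+
    let ?A = "\<lambda>p. Act (Const (fst p)) (Const (snd p)) :: ('b, 'c, 'f) tm"
    have tm1: "tree_tm (p # B) = Or (?A p) (tree_tm B)"
      and tm3: "tree_tm (p # B @ [q]) = Or (?A p) (tree_tm (B @ [q]))"
      using False by (cases B; simp)+
    have tm2: "eqv (tree_tm (B @ [q])) (Or (tree_tm B) (?A q)) (TBase b)"
      using tree_tm_append[of B "[q]" b] False ent by simp
    have A: "tyd (?A p) (TBase b)" using ent by (simp add: typing_entry)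
    have "eqv (tree_tm (p # B @ [q]))
        (if rew (fst q) \<le> rew (fst p) then Or (?A p) (tree_tm B) else Or (tree_tm B) (?A q)) (TBase b)"
      unfolding tm3
      by (rule derives.trans[OF derives.cong_Or[OF derives.refl[OF A] tm2]])
        (use or_or_eqv[OF c v B] in \<open>simp only: pq\<close>)
    then have "eqv (tree_tm (p # B @ [q]))
        (tree_tm (if rew (fst q) \<le> rew (fst p) then p # B else B @ [q])) (TBase b)"
      using tm1 derives.trans[OF _ derives.sym[OF tm2]] by (simp split: if_splits)
    moreover have "tree_sem b (p # B @ [q]) =
        tree_sem b (if rew (fst q) \<le> rew (fst p) then p # B else B @ [q])"
      using sem1 sem2 sem3 atom_or_or_atom[OF pq] by simp
    ultimately show ?thesis using ent by (simp add: same_def)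
  qed
qed

lemma same_shorter:
  assumes "entries b L" "\<not> distinct (map snd L)"
  shows "\<exists>L'. same b L L' \<and> length L' < length L"
proof -
  obtain xs y ys zs where "map snd L = xs @ [y] @ ys @ [y] @ zs"
    using not_distinct_decomp[OF assms(2)] by blast
  then obtain A p B q C where L: "L = A @ (p # B @ [q]) @ C" and pq: "snd p = snd q"
    by (auto simp: map_eq_append_conv map_eq_Cons_conv Cons_eq_map_conv append_eq_map_conv)
  let ?K = "if rew (fst q) \<le> rew (fst p) then p # B else B @ [q]"
  have "same b L (A @ ?K @ C)"
    unfolding L using assms(1) pq L by (intro same_append_left same_append_right same_prune) simp_all
  moreover have "length (A @ ?K @ C) < length L" unfolding L by simp
  ultimately show ?thesis by blast
qed

section \<open>Canonical forms of related terms\<close>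

definition represents :: "'b \<Rightarrow> ('c \<times> 'c) list \<Rightarrow> ('b, 'c, 'f) tm \<Rightarrow>
    (('r, 'd, 'u) val, 'r) sel \<Rightarrow> bool" where
  "represents b L M F \<longleftrightarrow> L \<noteq> [] \<and> entries b L \<and> eqv M (tree_tm L) (TBase b) \<and> F = tree_sem b L"

text \<open>Distributivity moves the outer reward to the leaves, where \<open>act_act_eqv\<close>
  merges it with the reward already there. The sum is again a constant because \<open>fval\<close>
  yields one.\<close>

lemma represents_act:
  assumes "L \<noteq> []" "entries b L" "cty \<Sigma> c = rewT \<Sigma>"
  shows "represents b (map (\<lambda>p. (cplus c (fst p), snd p)) L) (Act (Const c) (tree_tm L))
    (sel_act (den (TBase b)) (rew c) (tree_sem b L))"
  using assms
proof (induction L rule: tree_tm.induct)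
  case (2 p)
  then have p: "cty \<Sigma> (fst p) = rewT \<Sigma>" "tyd (Const (snd p)) (TBase b)"
    by (auto intro: typing.intros)
  have "sel_act (den (TBase b)) (rew c) (atom b p) = atom b (cplus c (fst p), snd p)"
    by (rule extensionalityI[of _ "den (TBase b) \<rightarrow>\<^sub>E UNIV"])
      (simp_all add: sel_act_apply atom_apply cplus(2)[OF 2(3) p(1)] atom_extensional del: tden.simps,
        simp add: sel_act_def)
  then show ?case
    using 2 act_act_eqv[OF 2(3) p] cplus(1)[OF 2(3) p(1)] by (simp add: represents_def)
next
  case (3 p q L)
  let ?f = "\<lambda>p. (cplus c (fst p), snd p)"
  let ?A = "\<lambda>p. Act (Const (fst p)) (Const (snd p)) :: ('b, 'c, 'f) tm"
  have ent: "entries b (q # L)" and p: "cty \<Sigma> (fst p) = rewT \<Sigma>" "cty \<Sigma> (snd p) = b"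
    using 3 by auto
  have p': "tyd (Const (snd p)) (TBase b)" using p by (auto intro: typing.intros)
  have ty: "tyd (?A p) (TBase b)" "tyd (tree_tm (q # L)) (TBase b)"
    using typing_entry[OF p] tree_tm_tyd[of "q # L"] ent by simp_all
  have IH: "represents b (map ?f (q # L)) (Act (Const c) (tree_tm (q # L)))
      (sel_act (den (TBase b)) (rew c) (tree_sem b (q # L)))"
    using 3 ent by blast
  have "eqv (Act (Const c) (tree_tm (p # q # L)))
      (Or (Act (Const c) (?A p)) (Act (Const c) (tree_tm (q # L)))) (TBase b)"
    using act_or_eqv[OF 3(4) ty] by simp
  from derives.trans[OF this derives.cong_Or[OF act_act_eqv[OF 3(4) p(1) p']]]
  have eqv: "eqv (Act (Const c) (tree_tm (p # q # L))) (tree_tm (map ?f (p # q # L))) (TBase b)"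
    using IH by (simp add: represents_def)
  have "sel_act (den (TBase b)) (rew c) (atom b p) = atom b (?f p)"
    by (rule extensionalityI[of _ "den (TBase b) \<rightarrow>\<^sub>E UNIV"])
      (simp_all add: sel_act_apply atom_apply cplus(2)[OF 3(4) p(1)] atom_extensional del: tden.simps,
        simp add: sel_act_def)
  then have "sel_act (den (TBase b)) (rew c) (tree_sem b (p # q # L)) = tree_sem b (map ?f (p # q # L))"
    using IH by (simp add: represents_def sel_act_or del: tden.simps)
  with eqv IH p cplus(1)[OF 3(4) p(1)] show ?case by (simp add: represents_def)
qed simp

lemma rel_represents:
  assumes "rel (TBase b) M F"
  shows "\<exists>L. represents b L M F"
  using assms
proof (induction rule: erel.induct)
  case (leaf M V v)
  then obtain c where c: "cty \<Sigma> c = b" "V = Const c" "v = BaseV (cden I c)"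
    by (auto simp: vrel.simps)
  have ty: "tyd V (TBase b)" using c by (auto intro: typing.intros)
  \<comment> \<open>A bare leaf becomes an entry with reward 0, so that all entries have one
    shape.\<close>
  have "eqv M (Act (Const (zeroC \<Sigma>)) V) (TBase b)"
    using leaf(2) derives.trans derives.sym derives.axiom selection_axioms.act_zero[OF ty] by blast
  moreover have "eta (den (TBase b)) v = atom b (zeroC \<Sigma>, c)"
    by (rule extensionalityI[of _ "den (TBase b) \<rightarrow>\<^sub>E UNIV"])
      (simp_all add: atom_apply atom_extensional eta_apply c rew_zero del: tden.simps,
        simp add: Defs.eta_def)
  ultimately have "represents b [(zeroC \<Sigma>, c)] M (eta (den (TBase b)) v)"
    using c cty_zero by (simp add: represents_def)
  then show ?case by blast
next
  case (choice L M N F G)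
  then obtain K K' where K: "represents b K M F" "represents b K' N G" by blast
  then have "eqv L (Or (tree_tm K) (tree_tm K')) (TBase b)"
    using derives.trans[OF choice(2) derives.cong_Or] by (simp add: represents_def)
  from derives.trans[OF this derives.sym[OF tree_tm_append]]
  have "represents b (K @ K') L (sel_or (den (TBase b)) F G)"
    using K by (simp add: represents_def tree_sem_append)
  then show ?case by blast
next
  case (reward L c M r F)
  then obtain K where K: "represents b K M F" by blast
  have r: "rew c = r" using reward by (simp add: rew_def)
  let ?K = "map (\<lambda>p. (cplus c (fst p), snd p)) K"
  have "eqv (Act (Const c) M) (Act (Const c) (tree_tm K)) (TBase b)"
    using K reward(3) by (auto simp: represents_def intro!: derives.cong_Act derives.refl typing.intros)
  moreover have "represents b ?K (Act (Const c) (tree_tm K)) (sel_act (den (TBase b)) r F)"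
    using represents_act[of K b c] K reward(3) r by (simp add: represents_def)
  ultimately have "represents b ?K L (sel_act (den (TBase b)) r F)"
    using derives.trans[OF reward(2) derives.trans] by (simp add: represents_def)
  then show ?case by blast
qed

lemma represents_distinct:
  assumes "represents b L M F"
  shows "\<exists>L'. represents b L' M F \<and> distinct (map snd L')"
  using assms
proof (induction L rule: length_induct)
  case (1 L)
  show ?case
  proof (cases "distinct (map snd L)")
    case False
    then obtain L' where L': "same b L L'" "length L' < length L"
      using same_shorter 1(2) unfolding represents_def by blast
    then have "represents b L' M F"
      using 1(2) derives.trans unfolding represents_def same_def by metis
    then show ?thesis using 1(1) L'(2) by blast
  qed (use 1 in blast)
qed

lemma rel_eta_const:
  assumes "rel (TBase b) M (eta (den (TBase b)) (BaseV a))"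
  shows "\<exists>c. cty \<Sigma> c = b \<and> eqv M (Const c) (TBase b)"
proof -
  obtain L where L: "L \<noteq> []" "entries b L" "eqv M (tree_tm L) (TBase b)"
    "eta (den (TBase b)) (BaseV a) = tree_sem b L" "distinct (map snd L)"
    using represents_distinct rel_represents[OF assms] unfolding represents_def by blast
  have all: "fst p = zeroC \<Sigma> \<and> cden I (snd p) = a \<and> cty \<Sigma> (snd p) = b" if p: "p \<in> set L" for p
  proof -
    have ty: "cty \<Sigma> (fst p) = rewT \<Sigma>" "cty \<Sigma> (snd p) = b"
      using L(2) p by (auto simp: entries_def)
    obtain \<gamma> where \<gamma>: "\<gamma> \<in> den (TBase b) \<rightarrow>\<^sub>E UNIV"
      "tree_sem b L \<gamma> = (rew (fst p), BaseV (cden I (snd p)))"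
      using tree_sem_selects[OF L(2,5) p] by blast
    then have "rew (fst p) = 0" "cden I (snd p) = a"
      using eta_apply[OF \<gamma>(1), of "BaseV a"] L(4) by auto
    \<comment> \<open>By injectivity on constants a reward denoting 0 is literally
      \<open>zeroC \<Sigma>\<close>, the form that \<open>act_zero\<close> requires, and values with
      equal denotation are the same constant.\<close>
    then show ?thesis
      using ty cden_RewV[OF ty(1)] cden_inj[of "fst p" "zeroC \<Sigma>"] cden_zero cty_zero
      by auto
  qed
  obtain p Q where p: "L = p # Q" using L(1) by (cases L) auto
  have "Q = []"
  proof (cases Q)
    case (Cons q R)
    then have "snd p = snd q" using all[of p] all[of q] p cden_inj by auto
    then show ?thesis using L(5) p Cons by simp
  qed simp
  then have "eqv M (Act (Const (zeroC \<Sigma>)) (Const (snd p))) (TBase b)"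
    using L(3) p all[of p] by simp
  moreover have "tyd (Const (snd p)) (TBase b)" using all[of p] p by (auto intro: typing.intros)
  ultimately have "eqv M (Const (snd p)) (TBase b)"
    using derives.trans derives.axiom selection_axioms.act_zero by blast
  then show ?thesis using all[of p] p by auto
qed

end

theorem corollary4p11:
  fixes \<Sigma> :: "('b, 'c, 'f) signature"
    and I :: "('b, 'c, 'f, 'r::{comm_monoid_add,linorder}, 'd) interp"
    and enc :: "('r, 'd, 'u) fn \<Rightarrow> 'u"
    and M :: "('b, 'c, 'f) tm"
    and b :: 'b
  assumes "signature_ok \<Sigma>"
    and "interp_ok \<Sigma> I"
    and "program \<Sigma> M (TBase b)"
    and "faithful I enc (occ_types \<Sigma> [] M)"
    and "sem_pure \<Sigma> I enc M b"
  shows "\<exists>c. cty \<Sigma> c = b \<and>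
    derives \<Sigma> (selection_axioms \<Sigma>) [] (Eqn M (Const c) (TBase b))"
proof -
  interpret selection_model \<Sigma> I enc "occ_types \<Sigma> [] M"
    using assms(1,2,4) by unfold_locales
  obtain a where a: "sem \<Sigma> I enc [] M [] = eta (tden I enc (TBase b)) (BaseV a)"
    using assms(5) unfolding sem_pure_def by blast
  have "rel (TBase b) (csubst 0 [] M) (sem \<Sigma> I enc [] M [])"
    using assms(3) unfolding program_def
    by (rule fundamental) (simp_all add: envrel_def)
  then show ?thesis
    using rel_eta_const[of b M a] a by (simp del: tden.simps)
qed

end
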